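(* Let $n\ge1$ and $r\in\{00,10,01,11\}$. The $\mathbb C(z,\hbar)$-linear maps $$W^{(r)}_\sigma:(\mathbb C^2)^{\otimes n}\otimes\mathbb C(z,\hbar)\to\mathbb W_n,\qquad 1_I\mapsto W^{(r)}_{\sigma,I}\qquad(\sigma\in S_n)$$ form local tensor coordinates on $(\mathbb C^2)^{\otimes n}$ with R-matrix $R^{(r)}$; that is, they are isomorphisms and for all $\sigma\in S_n$ and $a=1,\dots,n-1$ $$(W^{(r)}_{\sigma s_{a,a+1}})^{-1}\circ W^{(r)}_\sigma=R^{(r)}_{\sigma(a),\sigma(a+1)}(z_{\sigma(a+1)}-z_{\sigma(a)}).$$
   Context: Notation. $\mathbb C(z,\hbar)=\mathbb C(z_1,\dots,z_n,\hbar)$; $s_{a,b}\in S_n$ is the transposition of $a$ and $b$; $\sigma\omega$ means first apply $\omega$, then $\sigma$. For $I\subset\{1,\dots,n\}$ with $|I|=k$ write $I=\{i_1<\dots<i_k\}$. R-matrices. $v_1,v_2$ is the standard basis of $\mathbb C^2$. In the ordered basis $v_1\otimes v_1,v_1\otimes v_2,v_2\otimes v_1,v_2\otimes v_2$ put $$R^{(r)}(\zeta)=\begin{pmatrix}\alpha_r&0&0&0\\0&\frac{\zeta}{\hbar-\zeta}&\frac{\hbar}{\hbar-\zeta}&0\\0&\frac{\hbar}{\hbar-\zeta}&\frac{\zeta}{\hbar-\zeta}&0\\0&0&0&\beta_r\end{pmatrix},$$ with $\alpha_{00}=\alpha_{10}=1$, $\alpha_{01}=\alpha_{11}=\frac{\hbar+\zeta}{\hbar-\zeta}$,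 $\beta_{00}=\beta_{01}=1$, $\beta_{10}=\beta_{11}=\frac{\hbar+\zeta}{\hbar-\zeta}$. Each satisfies the Yang-Baxter equation $R_{12}(z_1-z_2)R_{13}(z_1-z_3)R_{23}(z_2-z_3)=R_{23}(z_2-z_3)R_{13}(z_1-z_3)R_{12}(z_1-z_2)$. $R_{u,v}(\zeta)$ denotes the endomorphism of $(\mathbb C^2)^{\otimes n}$ (with scalars extended) acting as $R(\zeta)$ in the $u$-th and $v$-th factors. Local tensor coordinates. Given such an $R$ and a vector space $V$ of dimension $2^n$ (over $\mathbb C(z,\hbar)$ after extension of scalars), a collection of $\mathbb C(z,\hbar)$-linear isomorphisms $L_\sigma:(\mathbb C^2)^{\otimes n}\otimes\mathbb C(z,\hbar)\to V$, $\sigma\in S_n$, is called local tensor coordinates on $(\mathbb C^2)^{\otimes n}$ with R-matrix $R$ if $L_{\sigma s_{a,a+1}}^{-1}\circ L_\sigma=R_{\sigma(a),\sigma(a+1)}(z_{\sigma(a+1)}-z_{\sigma(a)})$ for all $\sigma\in S_n$, $a=1,\dots,n-1$. Identification. $(\mathbb C^2)^{\otimes n}\otimes\mathbb C(z,\hbar)=\bigoplus_{I\subset\{1,\dots,n\}}\mathbb C(z,\hbar)\,1_I$ via $v_{j_1}\otimes\dots\otimes v_{j_n}\leftrightarrow1_I$, where $j_s=1$ if $s\notin I$ and $j_s=2$ if $s\in I$. Super weight functions. $\mathrm{Sym}_k f=\sum_{\tau\in S_k}f(t_{\tau(1)},\dots,t_{\tau(k)})$. For $|I|=k$ put $W^{(r)}_I=\mathrm{Sym}_k(U^{(r)}_I)$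 where $$U^{(00)}_I=\prod_{a=1}^k\Big(\prod_{b=1}^{i_a-1}(t_a-z_b+\hbar)\prod_{b=i_a+1}^n(z_b-t_a)\Big)\prod_{1\le a<b\le k}\frac1{(t_b-t_a+\hbar)(t_b-t_a)},$$ $$U^{(10)}_I=\prod_{a=1}^k\Big(\prod_{b=1}^{i_a-1}(t_a-z_b+\hbar)\prod_{b=i_a+1}^n(z_b-t_a)\Big)\prod_{1\le a<b\le k}\frac1{t_b-t_a},$$ $$U^{(01)}_I=\prod_{a=1}^k\Big(\prod_{b=1}^{i_a-1}(z_b-t_a+\hbar)\prod_{b=i_a+1}^n(z_b-t_a)\Big)\prod_{1\le a<b\le k}\frac1{t_b-t_a}\cdot\hbar^k\prod_{1\le a<b\le n}(z_b-z_a+\hbar)\prod_{a=1}^k\prod_{b=1}^n\frac1{z_b-t_a+\hbar},$$ $$U^{(11)}_I=\prod_{a=1}^k\Big(\prod_{b=1}^{i_a-1}(z_b-t_a+\hbar)\prod_{b=i_a+1}^n(z_b-t_a)\Big)\prod_{1\le a<b\le k}\frac{t_b-t_a+\hbar}{t_b-t_a}\cdot\hbar^k\prod_{1\le a<b\le n}(z_b-z_a+\hbar)\prod_{a=1}^k\prod_{b=1}^n\frac1{z_b-t_a+\hbar}.$$ For $\sigma\in S_n$ set $W^{(r)}_{\sigma,I}=W^{(r)}_{\sigma^{-1}(I)}(t_1,\dots,t_k,z_{\sigma(1)},\dots,z_{\sigma(n)})$, i.e. take $W^{(r)}_{\sigma^{-1}(I)}$ and replace each $z_b$ by $z_{\sigma(b)}$.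 The space $\mathbb W_n$ (for the fixed $r$). It is the $\mathbb C(z,\hbar)$-span of all $W^{(r)}_{\sigma,I}$, $I\subset\{1,\dots,n\}$, where the functions for different $k=|I|$ are placed in different direct summands: $\mathbb W_n=\bigoplus_{k=0}^n\mathrm{span}_{\mathbb C(z,\hbar)}\{W^{(r)}_{\sigma,I}:|I|=k\}\subset\bigoplus_{k=0}^n\mathbb C(t_1,\dots,t_k,z_1,\dots,z_n,\hbar)$. This space does not depend on $\sigma$. *)

theory Defs
  imports
    Complex_Main
    "HOL-Library.Poly_Mapping"
    "HOL-Computational_Algebra.Fraction_Field"
    "HOL-Combinatorics.Permutations"
begin

section \<open>Rational functions\<close>

datatype indet = Hbar | Z nat | T nat

text \<open>The linear order is irrelevant to the mathematics; the library needs one on the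
  indeterminates to conclude that the polynomial ring below is an integral domain.\<close>

primrec indet_code :: "indet \<Rightarrow> nat" where
  "indet_code Hbar = 0"
| "indet_code (Z b) = 2 * b + 1"
| "indet_code (T a) = 2 * a + 2"

lemma indet_code_inject: "indet_code x = indet_code y \<Longrightarrow> x = y"
  by (cases x; cases y; simp; presburger)

instantiation indet :: linorder
begin
definition less_eq_indet :: "indet \<Rightarrow> indet \<Rightarrow> bool" where
  "x \<le> y \<longleftrightarrow> indet_code x \<le> indet_code y"
definition less_indet :: "indet \<Rightarrow> indet \<Rightarrow> bool" where
  "x < y \<longleftrightarrow> indet_code x < indet_code y"
instance
  by standard (auto simp: less_eq_indet_def less_indet_def intro: indet_code_inject)
end

text \<open>Polynomials in all the indeterminates \<open>\<hbar>, z\<^sub>0, z\<^sub>1, \<dots>, t\<^sub>0, t\<^sub>1, \<dots>\<close> over the complex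
  numbers, and their field of fractions. The latter contains every field
  \<open>\<complex>(t\<^sub>1,\<dots>,t\<^sub>k,z\<^sub>1,\<dots>,z\<^sub>n,\<hbar>)\<close>.\<close>

type_synonym mpoly = "(indet \<Rightarrow>\<^sub>0 nat) \<Rightarrow>\<^sub>0 complex"
type_synonym ratfun = "mpoly fract"

definition var :: "indet \<Rightarrow> ratfun" where
  "var x = Fract (Poly_Mapping.single (Poly_Mapping.single x 1) 1) 1"

abbreviation hbar :: ratfun where "hbar \<equiv> var Hbar"

definition indets :: "mpoly \<Rightarrow> indet set" where
  "indets p = (\<Union>m\<in>Poly_Mapping.keys p. Poly_Mapping.keys m)"

text \<open>The subfield \<open>\<complex>(z\<^sub>1,\<dots>,z\<^sub>n,\<hbar>)\<close>.\<close>

definition Czh :: "nat \<Rightarrow> ratfun set" where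
  "Czh n = {Fract p q | p q. q \<noteq> 0 \<and> indets p \<subseteq> insert Hbar (Z ` {1..n})
                                  \<and> indets q \<subseteq> insert Hbar (Z ` {1..n})}"


section \<open>Vector spaces over \<open>\<complex>(z,\<hbar>)\<close>\<close>

text \<open>All vector spaces over \<open>Czh n\<close> are realised inside a space of functions into
  \<^typ>\<open>ratfun\<close>, with pointwise addition and scalar multiplication.\<close>

definition is_subspace :: "nat \<Rightarrow> ('i \<Rightarrow> ratfun) set \<Rightarrow> bool" where
  "is_subspace n V \<longleftrightarrow> (\<lambda>i. 0) \<in> V \<and> (\<forall>v\<in>V. \<forall>w\<in>V. (\<lambda>i. v i + w i) \<in> V) \<and>
     (\<forall>c\<in>Czh n. \<forall>v\<in>V. (\<lambda>i. c * v i) \<in> V)"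

definition lincomb :: "('i \<Rightarrow> ratfun) set \<Rightarrow> (('i \<Rightarrow> ratfun) \<Rightarrow> ratfun) \<Rightarrow> 'i \<Rightarrow> ratfun" where
  "lincomb A c = (\<lambda>i. \<Sum>v\<in>A. c v * v i)"

definition zh_span :: "nat \<Rightarrow> ('i \<Rightarrow> ratfun) set \<Rightarrow> ('i \<Rightarrow> ratfun) set" where
  "zh_span n S = {lincomb A c | A c. finite A \<and> A \<subseteq> S \<and> (\<forall>v\<in>A. c v \<in> Czh n)}"

definition zh_independent :: "nat \<Rightarrow> ('i \<Rightarrow> ratfun) set \<Rightarrow> bool" where
  "zh_independent n B \<longleftrightarrow> (\<forall>A c. finite A \<longrightarrow> A \<subseteq> B \<longrightarrow> (\<forall>v\<in>A. c v \<in> Czh n) \<longrightarrow>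
     lincomb A c = (\<lambda>i. 0) \<longrightarrow> (\<forall>v\<in>A. c v = 0))"

definition has_dimension :: "nat \<Rightarrow> ('i \<Rightarrow> ratfun) set \<Rightarrow> nat \<Rightarrow> bool" where
  "has_dimension n V d \<longleftrightarrow>
     (\<exists>B. B \<subseteq> V \<and> finite B \<and> card B = d \<and> zh_independent n B \<and> zh_span n B = V)"

definition linear_iso ::
  "nat \<Rightarrow> ('i \<Rightarrow> ratfun) set \<Rightarrow> ('j \<Rightarrow> ratfun) set \<Rightarrow> (('i \<Rightarrow> ratfun) \<Rightarrow> ('j \<Rightarrow> ratfun)) \<Rightarrow> bool"
where
  "linear_iso n V W L \<longleftrightarrow> bij_betw L V W \<and>
     (\<forall>v\<in>V. \<forall>w\<in>V. L (\<lambda>i. v i + w i) = (\<lambda>j. L v j + L w j)) \<and>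
     (\<forall>c\<in>Czh n. \<forall>v\<in>V. L (\<lambda>i. c * v i) = (\<lambda>j. c * L v j))"


section \<open>Tensors and R-matrices\<close>

text \<open>\<open>(\<complex>\<^sup>2)\<^bsup>\<otimes>n\<^esup> \<otimes> \<complex>(z,\<hbar>)\<close>, identified with \<open>\<Oplus>\<^sub>I \<complex>(z,\<hbar>) 1\<^sub>I\<close> over the subsets \<open>I\<close> of
  \<open>{1..n}\<close>: the element \<open>f\<close> stands for \<open>\<Sum>\<^sub>I f(I) 1\<^sub>I\<close>. Here \<open>1\<^sub>I\<close> is the basis tensor
  whose \<open>s\<close>-th factor is \<open>v\<^sub>j\<close> with \<open>j = letter I s\<close>.\<close>

definition tensor_space :: "nat \<Rightarrow> (nat set \<Rightarrow> ratfun) set" where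
  "tensor_space n = {f. (\<forall>I. I \<subseteq> {1..n} \<longrightarrow> f I \<in> Czh n) \<and> (\<forall>I. \<not> I \<subseteq> {1..n} \<longrightarrow> f I = 0)}"

definition letter :: "nat set \<Rightarrow> nat \<Rightarrow> nat" where
  "letter I s = (if s \<in> I then 2 else 1)"

datatype kind = K00 | K10 | K01 | K11

definition R_alpha :: "kind \<Rightarrow> ratfun \<Rightarrow> ratfun" where
  "R_alpha r \<zeta> = (case r of K00 \<Rightarrow> 1 | K10 \<Rightarrow> 1
     | K01 \<Rightarrow> (hbar + \<zeta>) / (hbar - \<zeta>) | K11 \<Rightarrow> (hbar + \<zeta>) / (hbar - \<zeta>))"

definition R_beta :: "kind \<Rightarrow> ratfun \<Rightarrow> ratfun" where
  "R_beta r \<zeta> = (case r of K00 \<Rightarrow> 1 | K01 \<Rightarrow> 1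
     | K10 \<Rightarrow> (hbar + \<zeta>) / (hbar - \<zeta>) | K11 \<Rightarrow> (hbar + \<zeta>) / (hbar - \<zeta>))"

text \<open>The list of rows, in the ordered basis
  \<open>v\<^sub>1 \<otimes> v\<^sub>1, v\<^sub>1 \<otimes> v\<^sub>2, v\<^sub>2 \<otimes> v\<^sub>1, v\<^sub>2 \<otimes> v\<^sub>2\<close>.\<close>

definition R_matrix :: "kind \<Rightarrow> ratfun \<Rightarrow> ratfun list list" where
  "R_matrix r \<zeta> =
    [[R_alpha r \<zeta>, 0,                  0,                  0         ],
     [0,           \<zeta> / (hbar - \<zeta>),     hbar / (hbar - \<zeta>),  0         ],
     [0,           hbar / (hbar - \<zeta>),  \<zeta> / (hbar - \<zeta>),     0         ],
     [0,           0,                  0,                  R_beta r \<zeta>]]"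

text \<open>\<open>v\<^sub>i \<otimes> v\<^sub>j\<close> is the basis vector in position \<open>pair_index i j\<close>, counting from 0.\<close>

definition pair_index :: "nat \<Rightarrow> nat \<Rightarrow> nat" where
  "pair_index i j = 2 * (i - 1) + (j - 1)"

text \<open>The endomorphism of the tensor space acting by the 4-by-4 matrix \<open>M\<close> in the factors
  \<open>u\<close> and \<open>v\<close> (in this order). Columns of \<open>M\<close> are the images of the basis vectors, so the
  coefficient of \<open>1\<^sub>J\<close> in the image of \<open>1\<^sub>I\<close> is an entry of \<open>M\<close> with row given by \<open>J\<close> and
  column by \<open>I\<close>, provided that the other tensor factors of \<open>1\<^sub>I\<close> and \<open>1\<^sub>J\<close> coincide.\<close>

definition act_in_factors ::
  "nat \<Rightarrow> ratfun list list \<Rightarrow> nat \<Rightarrow> nat \<Rightarrow> (nat set \<Rightarrow> ratfun) \<Rightarrow> (nat set \<Rightarrow> ratfun)" where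
  "act_in_factors n M u v f = (\<lambda>J. if J \<subseteq> {1..n} then
       (\<Sum>I\<in>{I. I \<subseteq> {1..n} \<and> (\<forall>s\<in>{1..n} - {u, v}. letter I s = letter J s)}.
          M ! pair_index (letter J u) (letter J v) ! pair_index (letter I u) (letter I v) * f I)
     else 0)"

definition local_tensor_coordinates ::
  "nat \<Rightarrow> (ratfun \<Rightarrow> ratfun list list) \<Rightarrow> ('i \<Rightarrow> ratfun) set \<Rightarrow>
   ((nat \<Rightarrow> nat) \<Rightarrow> (nat set \<Rightarrow> ratfun) \<Rightarrow> ('i \<Rightarrow> ratfun)) \<Rightarrow> bool" where
  "local_tensor_coordinates n R V L \<longleftrightarrow>
     is_subspace n V \<and> has_dimension n V (2 ^ n) \<and>
     (\<forall>\<sigma>. \<sigma> permutes {1..n} \<longrightarrow> linear_iso n (tensor_space n) V (L \<sigma>)) \<and>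
     (\<forall>\<sigma> a. \<sigma> permutes {1..n} \<longrightarrow> a \<in> {1..<n} \<longrightarrow>
        (\<forall>f\<in>tensor_space n.
           inv_into (tensor_space n) (L (\<sigma> \<circ> Transposition.transpose a (a + 1))) (L \<sigma> f) =
           act_in_factors n (R (var (Z (\<sigma> (a + 1))) - var (Z (\<sigma> a)))) (\<sigma> a) (\<sigma> (a + 1)) f))"


section \<open>Super weight functions\<close>

text \<open>\<open>nth_elem I a\<close> is \<open>i\<^sub>a\<close> for \<open>I = {i\<^sub>1 < \<dots> < i\<^sub>k}\<close> and \<open>1 \<le> a \<le> k\<close>.\<close>

definition nth_elem :: "nat set \<Rightarrow> nat \<Rightarrow> nat" where
  "nth_elem I a = sorted_list_of_set I ! (a - 1)"

text \<open>The functions \<open>U\<close> and \<open>W\<close> take the values substituted for the variables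
  \<open>t\<^sub>a\<close> and \<open>z\<^sub>b\<close> as arguments.\<close>

definition U_fun :: "kind \<Rightarrow> nat \<Rightarrow> nat set \<Rightarrow> (nat \<Rightarrow> ratfun) \<Rightarrow> (nat \<Rightarrow> ratfun) \<Rightarrow> ratfun" where
  "U_fun r n I t z = (let k = card I; i = nth_elem I in case r of
     K00 \<Rightarrow>
       (\<Prod>a=1..k. (\<Prod>b=1..<i a. t a - z b + hbar) * (\<Prod>b=i a + 1..n. z b - t a)) *
       (\<Prod>a=1..k. \<Prod>b=a+1..k. 1 / ((t b - t a + hbar) * (t b - t a)))
   | K10 \<Rightarrow>
       (\<Prod>a=1..k. (\<Prod>b=1..<i a. t a - z b + hbar) * (\<Prod>b=i a + 1..n. z b - t a)) *
       (\<Prod>a=1..k. \<Prod>b=a+1..k. 1 / (t b - t a))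
   | K01 \<Rightarrow>
       (\<Prod>a=1..k. (\<Prod>b=1..<i a. z b - t a + hbar) * (\<Prod>b=i a + 1..n. z b - t a)) *
       (\<Prod>a=1..k. \<Prod>b=a+1..k. 1 / (t b - t a)) *
       hbar ^ k * (\<Prod>a=1..n. \<Prod>b=a+1..n. z b - z a + hbar) *
       (\<Prod>a=1..k. \<Prod>b=1..n. 1 / (z b - t a + hbar))
   | K11 \<Rightarrow>
       (\<Prod>a=1..k. (\<Prod>b=1..<i a. z b - t a + hbar) * (\<Prod>b=i a + 1..n. z b - t a)) *
       (\<Prod>a=1..k. \<Prod>b=a+1..k. (t b - t a + hbar) / (t b - t a)) *
       hbar ^ k * (\<Prod>a=1..n. \<Prod>b=a+1..n. z b - z a + hbar) *
       (\<Prod>a=1..k. \<Prod>b=1..n. 1 / (z b - t a + hbar)))"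

definition Sym :: "nat \<Rightarrow> ((nat \<Rightarrow> ratfun) \<Rightarrow> ratfun) \<Rightarrow> (nat \<Rightarrow> ratfun) \<Rightarrow> ratfun" where
  "Sym k f t = (\<Sum>\<tau>\<in>{\<tau>. \<tau> permutes {1..k}}. f (\<lambda>a. t (\<tau> a)))"

definition W_fun :: "kind \<Rightarrow> nat \<Rightarrow> nat set \<Rightarrow> (nat \<Rightarrow> ratfun) \<Rightarrow> (nat \<Rightarrow> ratfun) \<Rightarrow> ratfun" where
  "W_fun r n I t z = Sym (card I) (\<lambda>t. U_fun r n I t z) t"

definition super_weight :: "kind \<Rightarrow> nat \<Rightarrow> (nat \<Rightarrow> nat) \<Rightarrow> nat set \<Rightarrow> ratfun" where
  "super_weight r n \<sigma> I = W_fun r n (inv \<sigma> ` I) (\<lambda>a. var (T a)) (\<lambda>b. var (Z (\<sigma> b)))"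

text \<open>An element of \<open>\<Oplus>\<^sub>k \<complex>(t\<^sub>1,\<dots>,t\<^sub>k,z\<^sub>1,\<dots>,z\<^sub>n,\<hbar>)\<close> is a function of \<open>k\<close>; the function
  attached to \<open>I\<close> is placed in the summand \<open>k = card I\<close>.\<close>

definition weight_vec :: "kind \<Rightarrow> nat \<Rightarrow> (nat \<Rightarrow> nat) \<Rightarrow> nat set \<Rightarrow> nat \<Rightarrow> ratfun" where
  "weight_vec r n \<sigma> I = (\<lambda>k. if k = card I then super_weight r n \<sigma> I else 0)"

definition weight_space :: "kind \<Rightarrow> nat \<Rightarrow> (nat \<Rightarrow> ratfun) set" where
  "weight_space r n = zh_span n {weight_vec r n \<sigma> I | \<sigma> I. \<sigma> permutes {1..n} \<and> I \<subseteq> {1..n}}"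

text \<open>The linear extension of \<open>1\<^sub>I \<mapsto> weight_vec r n \<sigma> I\<close>.\<close>

definition weight_map :: "kind \<Rightarrow> nat \<Rightarrow> (nat \<Rightarrow> nat) \<Rightarrow> (nat set \<Rightarrow> ratfun) \<Rightarrow> (nat \<Rightarrow> ratfun)" where
  "weight_map r n \<sigma> f = (\<lambda>k. \<Sum>I\<in>Pow {1..n}. f I * weight_vec r n \<sigma> I k)"

end

(* The symmetrisation of U_I is, up to a factor depending only on z, a sum over bijections
   labelling the points of I by the variables t_1, ..., t_k of a product of one-particle factors
   times a product of pair factors. In this form the R-matrix relation for an adjacent
   transposition only concerns the two sites a, a+1. It therefore reduces to rational identities in
   one t-variable (one of the two sites occupied) or in two t-variables, symmetrised (both sites
   occupied).
   For linear independence, substitute t = z_J: the value of W_I at z_J vanishes unless the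
   elements of J can be matched with elements of I dominating them, and W_J does not vanish at z_J.
   So in a vanishing linear combination the coefficient of the index set with the largest sum of
   elements is 0. *)

theory Submission
  imports Defs "HOL-Computational_Algebra.Polynomial_Factorial"
begin

section \<open>Specialisation of indeterminates\<close>

text \<open>The pair factors follow the order of the occupied sites, and an adjacent transposition
  reverses only the pair \<open>(a, Suc a)\<close>. Labelings of sites, unlike permutations of
  \<open>{1..k}\<close>, let a label move together with its particle, so everything away from the
  two sites is a common factor. The prefactor in \<open>z\<close> changes by exactly
  \<open>R_alpha\<close>, hence the shape of the relations for the remaining sum. With both sites
  occupied, single labelings do not suffice: two that differ by exchanging their labels at the two
  sites must be added.

  The relation is proved in the form "\<open>W\<close> for \<sigma> equals \<open>W\<close> for
  \<sigma>s after R", before anything is known about inverses. Since R has scalar entries, this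
  already shows that all these maps have the same image. Injectivity then gives bijectivity and
  turns the relation into the one with the inverse.

  Substituting points of \<open>z\<close> for \<open>t\<close> must respect denominators: the chosen
  points are distinct, and \<open>z b - t a + hbar\<close> becomes either a nonzero linear form or
  \<open>hbar\<close> itself. Scalars are fixed, so a linear relation survives the
  substitution.\<close>

definition eval_monom :: "(indet \<Rightarrow> ratfun) \<Rightarrow> (indet \<Rightarrow>\<^sub>0 nat) \<Rightarrow> ratfun" where
  "eval_monom v m = (\<Prod>x\<in>Poly_Mapping.keys m. v x ^ Poly_Mapping.lookup m x)"

definition eval_mpoly :: "(indet \<Rightarrow> ratfun) \<Rightarrow> mpoly \<Rightarrow> ratfun" where
  "eval_mpoly v p = (\<Sum>m\<in>Poly_Mapping.keys p.
     to_fract (Poly_Mapping.single 0 (Poly_Mapping.lookup p m)) * eval_monom v m)"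

lemma eval_monom_superset:
  assumes "finite S" "Poly_Mapping.keys m \<subseteq> S"
  shows "eval_monom v m = (\<Prod>x\<in>S. v x ^ Poly_Mapping.lookup m x)"
  unfolding eval_monom_def using assms
  by (intro prod.mono_neutral_left) (auto simp: in_keys_iff)

lemma eval_mpoly_superset:
  assumes "finite S" "Poly_Mapping.keys p \<subseteq> S"
  shows "eval_mpoly v p =
    (\<Sum>m\<in>S. to_fract (Poly_Mapping.single 0 (Poly_Mapping.lookup p m)) * eval_monom v m)"
  unfolding eval_mpoly_def using assms
  by (intro sum.mono_neutral_left) (auto simp: in_keys_iff)

lemma eval_monom_add: "eval_monom v (m + m') = eval_monom v m * eval_monom v m'"
proof -
  let ?S = "Poly_Mapping.keys m \<union> Poly_Mapping.keys m'"
  have "eval_monom v (m + m') = (\<Prod>x\<in>?S. v x ^ Poly_Mapping.lookup (m + m') x)"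
    by (rule eval_monom_superset) (auto dest: subsetD[OF keys_add])
  also have "\<dots> = (\<Prod>x\<in>?S. v x ^ Poly_Mapping.lookup m x) * (\<Prod>x\<in>?S. v x ^ Poly_Mapping.lookup m' x)"
    by (simp add: lookup_add power_add prod.distrib)
  also have "\<dots> = eval_monom v m * eval_monom v m'"
    by (intro arg_cong2[where f = "(*)"] eval_monom_superset[symmetric]) auto
  finally show ?thesis .
qed

lemma eval_mpoly_add: "eval_mpoly v (p + q) = eval_mpoly v p + eval_mpoly v q"
proof -
  let ?S = "Poly_Mapping.keys p \<union> Poly_Mapping.keys q"
  let ?c = "\<lambda>p m. to_fract (Poly_Mapping.single 0 (Poly_Mapping.lookup p m)) * eval_monom v m"
  have "eval_mpoly v (p + q) = (\<Sum>m\<in>?S. ?c (p + q) m)"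
    by (rule eval_mpoly_superset) (auto dest: subsetD[OF keys_add])
  also have "\<dots> = (\<Sum>m\<in>?S. ?c p m) + (\<Sum>m\<in>?S. ?c q m)"
    by (simp add: lookup_add single_add ring_distribs sum.distrib)
  also have "\<dots> = eval_mpoly v p + eval_mpoly v q"
    by (intro arg_cong2[where f = "(+)"] eval_mpoly_superset[symmetric]) auto
  finally show ?thesis .
qed

lemma eval_mpoly_0 [simp]: "eval_mpoly v 0 = 0"
  by (simp add: eval_mpoly_def)

lemma eval_mpoly_sum: "eval_mpoly v (\<Sum>i\<in>A. f i) = (\<Sum>i\<in>A. eval_mpoly v (f i))"
  by (induction A rule: infinite_finite_induct) (simp_all add: eval_mpoly_add)

lemma eval_mpoly_uminus: "eval_mpoly v (- p) = - eval_mpoly v p"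
  using eval_mpoly_add[of v p "- p"] by (simp add: add_eq_0_iff)

lemma eval_mpoly_diff: "eval_mpoly v (p - q) = eval_mpoly v p - eval_mpoly v q"
  using eval_mpoly_add[of v p "- q"] by (simp add: eval_mpoly_uminus)

lemma eval_mpoly_single:
  "eval_mpoly v (Poly_Mapping.single m c) = to_fract (Poly_Mapping.single 0 c) * eval_monom v m"
  by (cases "c = 0") (simp_all add: eval_mpoly_def)

lemma eval_mpoly_1 [simp]: "eval_mpoly v 1 = 1"
  using eval_mpoly_single[of v 0 1] by (simp add: eval_monom_def)

lemma sum_monomials:
  "(\<Sum>m\<in>Poly_Mapping.keys p. Poly_Mapping.single m (Poly_Mapping.lookup p m)) = p"
  by (rule poly_mapping_eqI)
    (auto simp: lookup_sum lookup_single when_def in_keys_iff sum.delta)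

text \<open>Multiplicativity on monomials extends bilinearly, once both factors are written as sums
  of their monomials.\<close>

lemma eval_mpoly_mult: "eval_mpoly v (p * q) = eval_mpoly v p * eval_mpoly v q"
proof -
  let ?p = "\<lambda>m. Poly_Mapping.single m (Poly_Mapping.lookup p m)"
  let ?q = "\<lambda>m. Poly_Mapping.single m (Poly_Mapping.lookup q m)"
  have single: "eval_mpoly v (Poly_Mapping.single m a * Poly_Mapping.single l b) =
      eval_mpoly v (Poly_Mapping.single m a) * eval_mpoly v (Poly_Mapping.single l b)" for m l a b
    by (simp add: mult_single eval_mpoly_single eval_monom_add mult_ac flip: to_fract_mult)
  have "p * q = (\<Sum>m\<in>Poly_Mapping.keys p. \<Sum>l\<in>Poly_Mapping.keys q. ?p m * ?q l)"
    unfolding sum_product[symmetric] sum_monomials ..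
  then have "eval_mpoly v (p * q) =
      (\<Sum>m\<in>Poly_Mapping.keys p. eval_mpoly v (?p m)) * (\<Sum>l\<in>Poly_Mapping.keys q. eval_mpoly v (?q l))"
    by (simp add: eval_mpoly_sum single sum_product)
  then show ?thesis
    by (simp only: eval_mpoly_sum[symmetric] sum_monomials)
qed

text \<open>Each monomial is reassembled from the powers of its variables. Consequently a
  substitution for the \<open>t\<close> variables alone acts trivially on scalars.\<close>

lemma eval_mpoly_var:
  assumes "\<And>x. x \<in> indets p \<Longrightarrow> v x = var x"
  shows "eval_mpoly v p = to_fract p"
proof -
  have pow: "Poly_Mapping.single (Poly_Mapping.single x 1) (1::complex) ^ k
      = Poly_Mapping.single (Poly_Mapping.single x k) 1" for x :: indet and k :: nat
    by (induction k) (simp_all add: mult_single flip: single_add)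
  have prod: "(\<Prod>x\<in>S. Poly_Mapping.single (f x) (1::complex)) = Poly_Mapping.single (\<Sum>x\<in>S. f x) 1"
    for S and f :: "indet \<Rightarrow> (indet \<Rightarrow>\<^sub>0 nat)"
    by (induction S rule: infinite_finite_induct) (simp_all add: mult_single)
  have to_fract_prod: "to_fract (\<Prod>x\<in>S. g x) = (\<Prod>x\<in>S. to_fract (g x))" for S and g :: "indet \<Rightarrow> mpoly"
    by (induction S rule: infinite_finite_induct) simp_all
  have to_fract_pow: "to_fract (g ^ k) = to_fract g ^ k" for g :: mpoly and k
    by (induction k) simp_all
  have to_fract_sum: "to_fract (\<Sum>x\<in>S. g x) = (\<Sum>x\<in>S. to_fract (g x))"
    for S and g :: "(indet \<Rightarrow>\<^sub>0 nat) \<Rightarrow> mpoly"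
    by (induction S rule: infinite_finite_induct) simp_all
  have monom: "eval_monom v m = to_fract (Poly_Mapping.single m 1)" if "m \<in> Poly_Mapping.keys p" for m
  proof -
    have "v x = var x" if "x \<in> Poly_Mapping.keys m" for x
      using assms that \<open>m \<in> Poly_Mapping.keys p\<close> by (auto simp: indets_def)
    then have "eval_monom v m = (\<Prod>x\<in>Poly_Mapping.keys m. var x ^ Poly_Mapping.lookup m x)"
      by (simp add: eval_monom_def)
    also have "\<dots> = to_fract (\<Prod>x\<in>Poly_Mapping.keys m.
        Poly_Mapping.single (Poly_Mapping.single x (Poly_Mapping.lookup m x)) 1)"
      by (simp only: to_fract_prod var_def to_fract_def[symmetric] to_fract_pow[symmetric] pow)
    also have "\<dots> = to_fract (Poly_Mapping.single m 1)"
      by (simp add: prod sum_monomials)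
    finally show ?thesis .
  qed
  have "eval_mpoly v p =
      to_fract (\<Sum>m\<in>Poly_Mapping.keys p. Poly_Mapping.single m (Poly_Mapping.lookup p m))"
    unfolding eval_mpoly_def to_fract_sum
    by (intro sum.cong refl) (simp add: monom mult_single flip: to_fract_mult)
  then show ?thesis by (simp add: sum_monomials)
qed

text \<open>Evaluation is only partially defined on fractions, hence a relation.\<close>

definition specialises :: "(indet \<Rightarrow> ratfun) \<Rightarrow> ratfun \<Rightarrow> ratfun \<Rightarrow> bool" where
  "specialises v f g \<longleftrightarrow> (\<exists>p q. q \<noteq> 0 \<and> f = Fract p q \<and> eval_mpoly v q \<noteq> 0 \<and>
     g = eval_mpoly v p / eval_mpoly v q)"

lemma specialisesI:
  "q \<noteq> 0 \<Longrightarrow> eval_mpoly v q \<noteq> 0 \<Longrightarrow> specialises v (Fract p q) (eval_mpoly v p / eval_mpoly v q)"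
  unfolding specialises_def by blast

section \<open>Compatibility of specialisation with the field operations\<close>

lemma specialises_add:
  "specialises v f g \<Longrightarrow> specialises v f' g' \<Longrightarrow> specialises v (f + f') (g + g')"
  unfolding specialises_def
  apply (elim exE conjE)
  subgoal for p p' q q'
    by (rule exI[of _ "p * q' + p' * q"], rule exI[of _ "q * q'"])
      (simp add: eval_mpoly_add eval_mpoly_mult add_frac_eq)
  done

lemma specialises_diff:
  "specialises v f g \<Longrightarrow> specialises v f' g' \<Longrightarrow> specialises v (f - f') (g - g')"
  unfolding specialises_def
  apply (elim exE conjE)
  subgoal for p p' q q'
    by (rule exI[of _ "p * q' - p' * q"], rule exI[of _ "q * q'"])
      (simp add: eval_mpoly_diff eval_mpoly_mult diff_frac_eq)
  done

lemma specialises_mult: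
  "specialises v f g \<Longrightarrow> specialises v f' g' \<Longrightarrow> specialises v (f * f') (g * g')"
  unfolding specialises_def
  apply (elim exE conjE)
  subgoal for p p' q q'
    by (rule exI[of _ "p * p'"], rule exI[of _ "q * q'"])
      (simp add: eval_mpoly_mult)
  done

lemma specialises_divide:
  "specialises v f g \<Longrightarrow> specialises v f' g' \<Longrightarrow> g' \<noteq> 0 \<Longrightarrow> specialises v (f / f') (g / g')"
  unfolding specialises_def
  apply (elim exE conjE)
  subgoal for p p' q q'
    by (rule exI[of _ "p * q'"], rule exI[of _ "q * p'"])
      (auto simp: eval_mpoly_mult)
  done

lemma specialises_0: "specialises v 0 0"
  using specialisesI[of 1 v 0] by (simp flip: Zero_fract_def)

lemma specialises_1: "specialises v 1 1"
  using specialisesI[of 1 v 1] by (simp flip: One_fract_def)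

lemma specialises_sum:
  "(\<And>i. i \<in> A \<Longrightarrow> specialises v (f i) (g i)) \<Longrightarrow> specialises v (\<Sum>i\<in>A. f i) (\<Sum>i\<in>A. g i)"
  by (induction A rule: infinite_finite_induct) (simp_all add: specialises_add specialises_0)

lemma specialises_prod:
  "(\<And>i. i \<in> A \<Longrightarrow> specialises v (f i) (g i)) \<Longrightarrow> specialises v (\<Prod>i\<in>A. f i) (\<Prod>i\<in>A. g i)"
  by (induction A rule: infinite_finite_induct) (simp_all add: specialises_mult specialises_1)

lemma specialises_var: "specialises v (var x) (v x)"
proof -
  have "eval_mpoly v (Poly_Mapping.single (Poly_Mapping.single x 1) 1) = v x"
    by (simp add: eval_mpoly_single eval_monom_def)
  then show ?thesis
    using specialisesI[of 1 v "Poly_Mapping.single (Poly_Mapping.single x 1) 1"]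
    by (simp add: var_def)
qed

text \<open>The instance of uniqueness of values on which the independence argument rests: a
  vanishing linear combination cannot specialise to anything else, whichever fraction represents
  it.\<close>

lemma specialises_zeroD:
  assumes "specialises v 0 g" shows "g = 0"
proof -
  from assms obtain p q where "q \<noteq> 0" "0 = Fract p q" and g: "g = eval_mpoly v p / eval_mpoly v q"
    unfolding specialises_def by blast
  then have "p = 0" by (simp add: Zero_fract_def eq_fract)
  with g show ?thesis by simp
qed

lemma specialises_Czh:
  assumes "c \<in> Czh n" "v Hbar = hbar" "\<And>b. b \<in> {1..n} \<Longrightarrow> v (Z b) = var (Z b)"
  shows "specialises v c c"
proof -
  from assms(1) obtain p q where c: "c = Fract p q" "q \<noteq> 0"
    "indets p \<subseteq> insert Hbar (Z ` {1..n})" "indets q \<subseteq> insert Hbar (Z ` {1..n})"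
    unfolding Czh_def by blast
  have "eval_mpoly v p = to_fract p" "eval_mpoly v q = to_fract q"
    using c assms by (auto intro!: eval_mpoly_var)
  then show ?thesis
    using c specialisesI[of q v p] by (simp add: to_fract_def[symmetric]) (simp add: to_fract_def)
qed

section \<open>The field of scalars\<close>

lemma indets_0 [simp]: "indets 0 = {}" and indets_1 [simp]: "indets 1 = {}"
  by (simp_all add: indets_def)

lemma indets_add: "indets (p + q) \<subseteq> indets p \<union> indets q"
  using keys_add[of p q] by (auto simp: indets_def)

lemma indets_uminus [simp]: "indets (- p) = indets p"
  by (simp add: indets_def)

lemma indets_mult: "indets (p * q) \<subseteq> indets p \<union> indets q"
proof
  fix x assume "x \<in> indets (p * q)"
  then obtain m where "m \<in> Poly_Mapping.keys (p * q)" "x \<in> Poly_Mapping.keys m"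
    by (auto simp: indets_def)
  with keys_mult[of p q] obtain a b where "a \<in> Poly_Mapping.keys p" "b \<in> Poly_Mapping.keys q"
    "x \<in> Poly_Mapping.keys (a + b)" by blast
  with keys_add[of a b] show "x \<in> indets p \<union> indets q" by (auto simp: indets_def)
qed

lemma CzhI:
  "q \<noteq> 0 \<Longrightarrow> indets p \<subseteq> insert Hbar (Z ` {1..n}) \<Longrightarrow> indets q \<subseteq> insert Hbar (Z ` {1..n}) \<Longrightarrow>
    Fract p q \<in> Czh n"
  unfolding Czh_def by blast

lemma Czh_0 [simp]: "0 \<in> Czh n"
  unfolding Zero_fract_def by (rule CzhI) simp_all

lemma Czh_1 [simp]: "1 \<in> Czh n"
  unfolding One_fract_def by (rule CzhI) simp_all

lemma Czh_mult:
  assumes "x \<in> Czh n" "y \<in> Czh n" shows "x * y \<in> Czh n"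
proof -
  from assms obtain p q p' q' where "x = Fract p q" "y = Fract p' q'" "q \<noteq> 0" "q' \<noteq> 0"
    "indets p \<union> indets q \<union> indets p' \<union> indets q' \<subseteq> insert Hbar (Z ` {1..n})"
    unfolding Czh_def by blast
  then show ?thesis
    using indets_mult[of p p'] indets_mult[of q q']
    by (simp only: mult_fract, intro CzhI) auto
qed

lemma Czh_add:
  assumes "x \<in> Czh n" "y \<in> Czh n" shows "x + y \<in> Czh n"
proof -
  from assms obtain p q p' q' where "x = Fract p q" "y = Fract p' q'" "q \<noteq> 0" "q' \<noteq> 0"
    "indets p \<union> indets q \<union> indets p' \<union> indets q' \<subseteq> insert Hbar (Z ` {1..n})"
    unfolding Czh_def by blast
  then show ?thesis
    using indets_mult[of p q'] indets_mult[of p' q] indets_mult[of q q']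
      indets_add[of "p * q'" "p' * q"]
    by (simp only: add_fract simp_thms, intro CzhI) (simp, blast, blast)
qed

lemma Czh_uminus:
  assumes "x \<in> Czh n" shows "- x \<in> Czh n"
proof -
  from assms obtain p q where "x = Fract p q" "q \<noteq> 0"
    "indets p \<subseteq> insert Hbar (Z ` {1..n})" "indets q \<subseteq> insert Hbar (Z ` {1..n})"
    unfolding Czh_def by blast
  then show ?thesis
    by (simp only: minus_fract, intro CzhI) auto
qed

lemma Czh_inverse:
  assumes "x \<in> Czh n" shows "inverse x \<in> Czh n"
proof (cases "x = 0")
  case False
  from assms obtain p q where "x = Fract p q" "q \<noteq> 0"
    "indets p \<subseteq> insert Hbar (Z ` {1..n})" "indets q \<subseteq> insert Hbar (Z ` {1..n})"
    unfolding Czh_def by blast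
  with False show ?thesis
    by (simp only: inverse_fract, intro CzhI) (auto simp: fract_collapse)
qed simp

lemma Czh_diff: "x \<in> Czh n \<Longrightarrow> y \<in> Czh n \<Longrightarrow> x - y \<in> Czh n"
  using Czh_add[OF _ Czh_uminus] by force

lemma Czh_divide: "x \<in> Czh n \<Longrightarrow> y \<in> Czh n \<Longrightarrow> x / y \<in> Czh n"
  by (simp add: divide_inverse Czh_mult Czh_inverse)

lemma Czh_sum: "(\<And>i. i \<in> A \<Longrightarrow> f i \<in> Czh n) \<Longrightarrow> (\<Sum>i\<in>A. f i) \<in> Czh n"
  by (induction A rule: infinite_finite_induct) (simp_all add: Czh_add)

lemma Czh_hbar [simp]: "hbar \<in> Czh n"
  unfolding var_def by (rule CzhI) (simp_all add: indets_def)

lemma Czh_var_Z: "b \<in> {1..n} \<Longrightarrow> var (Z b) \<in> Czh n"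
  unfolding var_def by (rule CzhI) (simp_all add: indets_def)

text \<open>The monomial \<open>x\<close> has coefficient 1 in the numerator polynomial. The case
  \<open>y = Hbar\<close> is covered as well.\<close>

lemma var_add_hbar_ne_0:
  assumes "x \<noteq> y" "x \<noteq> Hbar"
  shows "var x - var y + hbar \<noteq> 0" "var x - var y \<noteq> 0"
proof -
  have inj: "Poly_Mapping.single z (Suc 0) = Poly_Mapping.single x (Suc 0) \<longleftrightarrow> z = x" for z
    by (metis keys_single nat.simps(3) singleton_inject)
  let ?v = "\<lambda>x. Poly_Mapping.single (Poly_Mapping.single x 1) 1 :: mpoly"
  have "Poly_Mapping.lookup (?v x - ?v y + ?v Hbar) (Poly_Mapping.single x 1) = 1"
    "Poly_Mapping.lookup (?v x - ?v y) (Poly_Mapping.single x 1) = 1"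
    using assms by (auto simp: lookup_add lookup_minus lookup_single when_def inj)
  then have "?v x - ?v y + ?v Hbar \<noteq> 0" "?v x - ?v y \<noteq> 0" by fastforce+
  moreover have "var z = to_fract (?v z)" for z by (simp add: var_def to_fract_def)
  ultimately show "var x - var y + hbar \<noteq> 0" "var x - var y \<noteq> 0"
    by (simp_all flip: to_fract_diff to_fract_add)
qed

lemma hbar_ne_0: "hbar \<noteq> 0"
proof
  assume "hbar = 0"
  then have "to_fract (Poly_Mapping.single (Poly_Mapping.single Hbar (1::nat)) (1::complex)) = 0"
    by (simp only: var_def to_fract_def)
  then show False by (metis lookup_single_eq lookup_zero to_fract_eq_0_iff zero_neq_one)
qed

section \<open>Super weight functions as sums over configurations\<close>

definition lower_factor :: "kind \<Rightarrow> ratfun \<Rightarrow> ratfun \<Rightarrow> ratfun" where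
  "lower_factor r t z = (case r of K00 \<Rightarrow> t - z + hbar | K10 \<Rightarrow> t - z + hbar
     | K01 \<Rightarrow> z - t + hbar | K11 \<Rightarrow> z - t + hbar)"

definition common_factor :: "kind \<Rightarrow> ratfun \<Rightarrow> ratfun \<Rightarrow> ratfun" where
  "common_factor r t z = (case r of K00 \<Rightarrow> 1 | K10 \<Rightarrow> 1
     | K01 \<Rightarrow> 1 / (z - t + hbar) | K11 \<Rightarrow> 1 / (z - t + hbar))"

text \<open>The factor \<open>hbar ^ k\<close> of the kinds 01 and 11, distributed over the
  \<open>k\<close> particles.\<close>

definition mass :: "kind \<Rightarrow> ratfun" where
  "mass r = (case r of K00 \<Rightarrow> 1 | K10 \<Rightarrow> 1 | K01 \<Rightarrow> hbar | K11 \<Rightarrow> hbar)"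

definition pair_factor :: "kind \<Rightarrow> ratfun \<Rightarrow> ratfun \<Rightarrow> ratfun" where
  "pair_factor r t u = (case r of K00 \<Rightarrow> 1 / ((u - t + hbar) * (u - t)) | K10 \<Rightarrow> 1 / (u - t)
     | K01 \<Rightarrow> 1 / (u - t) | K11 \<Rightarrow> (u - t + hbar) / (u - t))"

definition site_factor :: "kind \<Rightarrow> nat \<Rightarrow> nat \<Rightarrow> ratfun \<Rightarrow> ratfun \<Rightarrow> ratfun" where
  "site_factor r i b t z =
     (if b < i then lower_factor r t z else if i < b then z - t else 1) * common_factor r t z"

definition particle_factor :: "kind \<Rightarrow> nat \<Rightarrow> nat \<Rightarrow> ratfun \<Rightarrow> (nat \<Rightarrow> ratfun) \<Rightarrow> ratfun" where
  "particle_factor r n i t z = mass r * (\<Prod>b=1..n. site_factor r i b t (z b))"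

definition ordered_pairs :: "nat set \<Rightarrow> (nat \<times> nat) set" where
  "ordered_pairs I = {(i, j). i \<in> I \<and> j \<in> I \<and> i < j}"

definition prefactor :: "kind \<Rightarrow> nat \<Rightarrow> (nat \<Rightarrow> ratfun) \<Rightarrow> ratfun" where
  "prefactor r n z = (case r of K00 \<Rightarrow> 1 | K10 \<Rightarrow> 1
     | K01 \<Rightarrow> \<Prod>(a, b)\<in>ordered_pairs {1..n}. z b - z a + hbar
     | K11 \<Rightarrow> \<Prod>(a, b)\<in>ordered_pairs {1..n}. z b - z a + hbar)"

text \<open>\<open>x i\<close> is the variable carried by the particle at site \<open>i\<close>. The
  pair factors are oriented by the order of the sites, not of the labels.\<close>

definition config_weight ::
  "kind \<Rightarrow> nat \<Rightarrow> nat set \<Rightarrow> (nat \<Rightarrow> ratfun) \<Rightarrow> (nat \<Rightarrow> ratfun) \<Rightarrow> ratfun" where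
  "config_weight r n I x z = (\<Prod>i\<in>I. particle_factor r n i (x i) z) *
     (\<Prod>(i, j)\<in>ordered_pairs I. pair_factor r (x i) (x j))"

text \<open>Extensional functions, so that every bijection is counted once. The labeling belonging
  to a permutation \<tau> sends the \<open>a\<close>-th element of \<open>I\<close> to
  \<open>\<tau> a\<close>.\<close>

definition labelings :: "nat set \<Rightarrow> (nat \<Rightarrow> nat) set" where
  "labelings I = {\<beta> \<in> I \<rightarrow>\<^sub>E {1..card I}. bij_betw \<beta> I {1..card I}}"

definition core_weight ::
  "kind \<Rightarrow> nat \<Rightarrow> nat set \<Rightarrow> (nat \<Rightarrow> ratfun) \<Rightarrow> (nat \<Rightarrow> ratfun) \<Rightarrow> ratfun" where
  "core_weight r n I t z = (\<Sum>\<beta>\<in>labelings I. config_weight r n I (t \<circ> \<beta>) z)"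

section \<open>Reindexing the weight functions by sites\<close>

lemma config_weight_cong:
  assumes "\<And>i. i \<in> I \<Longrightarrow> x i = y i"
  shows "config_weight r n I x z = config_weight r n I y z"
  unfolding config_weight_def using assms
  by (intro arg_cong2[where f = "(*)"] prod.cong) (auto simp: ordered_pairs_def)

lemma prod_ordered_pairs_atLeastAtMost:
  "(\<Prod>a=1..k. \<Prod>b=a+1..k. f a b) = (\<Prod>(a, b)\<in>ordered_pairs {1..k}. f a b)"
proof -
  have "ordered_pairs {1..k} = Sigma {1..k} (\<lambda>a. {a+1..k})"
    by (auto simp: ordered_pairs_def)
  then show ?thesis by (simp add: prod.Sigma)
qed

lemma nth_elem_bij_betw:
  assumes "finite I" shows "bij_betw (nth_elem I) {1..card I} I"
proof -
  have "bij_betw (\<lambda>a. a - 1) {1..card I} {..<card I}"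
    by (rule bij_betwI[where g = Suc]) auto
  moreover have "bij_betw ((!) (sorted_list_of_set I)) {..<card I} I"
    using assms by (intro bij_betw_nth) auto
  ultimately have "bij_betw ((!) (sorted_list_of_set I) \<circ> (\<lambda>a. a - 1)) {1..card I} I"
    by (rule bij_betw_trans)
  then show ?thesis by (simp add: nth_elem_def[abs_def] comp_def)
qed

lemma nth_elem_less_iff:
  assumes "finite I" "a \<in> {1..card I}" "b \<in> {1..card I}"
  shows "nth_elem I a < nth_elem I b \<longleftrightarrow> a < b"
proof -
  have "nth_elem I a < nth_elem I b" if "a < b" "a \<in> {1..card I}" "b \<in> {1..card I}" for a b
    unfolding nth_elem_def using that assms(1)
    by (intro sorted_wrt_nth_less[OF strict_sorted_list_of_set]) auto
  then show ?thesis using assms by (metis linorder_neqE_nat order_less_asym order_less_irrefl)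
qed

lemma particle_factor_split:
  assumes "i \<in> {1..n}"
  shows "particle_factor r n i t z = mass r *
    ((\<Prod>b=1..<i. lower_factor r t (z b)) * (\<Prod>b=i+1..n. z b - t)) *
    (\<Prod>b=1..n. common_factor r t (z b))"
proof -
  let ?f = "\<lambda>b. if b < i then lower_factor r t (z b) else if i < b then z b - t else 1"
  have "{1..n} = {1..<i} \<union> {i} \<union> {i+1..n}" using assms by auto
  then have "prod ?f {1..n} = prod ?f ({1..<i} \<union> {i} \<union> {i+1..n})" by simp
  also have "\<dots> = prod ?f {1..<i} * prod ?f {i+1..n}"
    by (subst prod.union_disjoint; (auto)[])+
  also have "\<dots> = (\<Prod>b=1..<i. lower_factor r t (z b)) * (\<Prod>b=i+1..n. z b - t)"
    by (intro arg_cong2[where f = "(*)"] prod.cong) auto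
  finally show ?thesis
    by (simp add: particle_factor_def site_factor_def prod.distrib)
qed

text \<open>The enumeration of \<open>I\<close> is increasing, so pairs of indices
  \<open>a < b\<close> correspond to pairs of occupied sites in the same order. The argument of
  \<open>config_weight\<close> puts \<open>t a\<close> on the \<open>a\<close>-th element of
  \<open>I\<close>.\<close>

lemma U_fun_eq:
  assumes "I \<subseteq> {1..n}"
  shows "U_fun r n I t z =
    prefactor r n z * config_weight r n I (\<lambda>i. t (inv_into {1..card I} (nth_elem I) i)) z"
proof -
  have fin: "finite I" using assms finite_subset by blast
  let ?i = "nth_elem I" and ?k = "card I"
  let ?x = "\<lambda>i. t (inv_into {1..?k} ?i i)"
  note bij = nth_elem_bij_betw[OF fin]
  have x: "?x (?i a) = t a" if "a \<in> {1..?k}" for a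
    using bij that by (simp add: bij_betw_inv_into_left)
  have mem: "?i a \<in> {1..n}" if "a \<in> {1..?k}" for a
    using bij_betw_apply[OF bij that] assms by blast
  have "(\<Prod>i\<in>I. particle_factor r n i (?x i) z) = (\<Prod>a=1..?k. particle_factor r n (?i a) (?x (?i a)) z)"
    by (rule prod.reindex_bij_betw[OF bij, symmetric])
  also have "\<dots> = (\<Prod>a=1..?k. mass r *
    ((\<Prod>b=1..<?i a. lower_factor r (t a) (z b)) * (\<Prod>b=?i a+1..n. z b - t a)) *
    (\<Prod>b=1..n. common_factor r (t a) (z b)))"
    by (intro prod.cong refl) (simp only: particle_factor_split[OF mem] x)
  finally have single: "(\<Prod>i\<in>I. particle_factor r n i (?x i) z) = mass r ^ ?k *
    (\<Prod>a=1..?k. (\<Prod>b=1..<?i a. lower_factor r (t a) (z b)) * (\<Prod>b=?i a+1..n. z b - t a)) *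
    (\<Prod>a=1..?k. \<Prod>b=1..n. common_factor r (t a) (z b))"
    by (simp add: prod.distrib)
  have "bij_betw (map_prod ?i ?i) (ordered_pairs {1..?k}) (ordered_pairs I)"
  proof (rule bij_betwI'[where f = "map_prod ?i ?i"])
    show "(map_prod ?i ?i p = map_prod ?i ?i q) = (p = q)"
      if "p \<in> ordered_pairs {1..?k}" "q \<in> ordered_pairs {1..?k}" for p q
      using that bij_betw_imp_inj_on[OF bij] by (auto simp: ordered_pairs_def inj_on_eq_iff)
    show "map_prod ?i ?i p \<in> ordered_pairs I" if "p \<in> ordered_pairs {1..?k}" for p
      using that bij_betw_apply[OF bij] nth_elem_less_iff[OF fin] by (auto simp: ordered_pairs_def)
    show "\<exists>p\<in>ordered_pairs {1..?k}. q = map_prod ?i ?i p" if "q \<in> ordered_pairs I" for q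
    proof -
      from that obtain i j where q: "q = (i, j)" "i \<in> I" "j \<in> I" "i < j"
        by (auto simp: ordered_pairs_def)
      with bij obtain a b where ab: "a \<in> {1..?k}" "b \<in> {1..?k}" "i = ?i a" "j = ?i b"
        unfolding bij_betw_def by (metis imageE)
      with q nth_elem_less_iff[OF fin ab(1,2)] have "(a, b) \<in> ordered_pairs {1..?k}"
        by (simp add: ordered_pairs_def)
      then show ?thesis using q ab by (intro bexI[of _ "(a, b)"]) auto
    qed
  qed
  then have "(\<Prod>(i, j)\<in>ordered_pairs I. pair_factor r (?x i) (?x j)) =
      (\<Prod>p\<in>ordered_pairs {1..?k}. case map_prod ?i ?i p of (i, j) \<Rightarrow> pair_factor r (?x i) (?x j))"
    by (rule prod.reindex_bij_betw[symmetric])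
  also have "\<dots> = (\<Prod>(a, b)\<in>ordered_pairs {1..?k}. pair_factor r (t a) (t b))"
    by (intro prod.cong refl) (auto simp: ordered_pairs_def x simp del: One_nat_def)
  finally have pair: "(\<Prod>(i, j)\<in>ordered_pairs I. pair_factor r (?x i) (?x j)) =
      (\<Prod>a=1..?k. \<Prod>b=a+1..?k. pair_factor r (t a) (t b))"
    by (simp only: prod_ordered_pairs_atLeastAtMost)
  show ?thesis
    unfolding U_fun_def config_weight_def single pair Let_def prefactor_def
      prod_ordered_pairs_atLeastAtMost[symmetric]
    by (cases r) (simp_all add: mass_def lower_factor_def common_factor_def pair_factor_def mult_ac)
qed

text \<open>Permuting the variables and then placing them on \<open>I\<close> in increasing order
  amounts to choosing an arbitrary labeling; the prefactor is free of \<open>t\<close> and leaves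
  the sum.\<close>

lemma W_fun_eq:
  assumes "I \<subseteq> {1..n}"
  shows "W_fun r n I t z = prefactor r n z * core_weight r n I t z"
proof -
  have fin: "finite I" using assms finite_subset by blast
  let ?i = "nth_elem I" and ?k = "card I"
  let ?r = "inv_into {1..?k} ?i"
  note bij = nth_elem_bij_betw[OF fin]
  have bij': "bij_betw ?r I {1..?k}" using bij by (rule bij_betw_inv_into)
  have ri: "?r (?i a) = a" if "a \<in> {1..?k}" for a
    using bij that by (simp add: bij_betw_inv_into_left)
  have ir: "?i (?r j) = j" if "j \<in> I" for j
    using bij that by (simp add: bij_betw_inv_into_right)
  have imem: "?i a \<in> I" if "a \<in> {1..?k}" for a using bij that by (auto simp: bij_betw_def)
  have rmem: "?r j \<in> {1..?k}" if "j \<in> I" for j using bij' that by (auto simp: bij_betw_def)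
  have "(\<Sum>\<tau>\<in>{\<tau>. \<tau> permutes {1..?k}}. config_weight r n I (\<lambda>i. t (\<tau> (?r i))) z) =
      (\<Sum>\<beta>\<in>labelings I. config_weight r n I (t \<circ> \<beta>) z)"
  \<comment> \<open>A permutation has to be the identity outside \<open>{1..k}\<close>, and a
    labeling undefined outside \<open>I\<close>; hence the default value \<open>a\<close> in one
    witness and the restriction in the other.\<close>
  proof (rule sum.reindex_bij_witness[where
      i = "\<lambda>\<beta> a. if a \<in> {1..?k} then \<beta> (?i a) else a" and j = "\<lambda>\<tau>. restrict (\<tau> \<circ> ?r) I"])
    fix \<tau> assume "\<tau> \<in> {\<tau>. \<tau> permutes {1..?k}}"
    then have \<tau>: "\<tau> permutes {1..?k}" by simp
    show "(\<lambda>a. if a \<in> {1..?k} then restrict (\<tau> \<circ> ?r) I (?i a) else a) = \<tau>"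
      using permutes_not_in[OF \<tau>] by (auto simp: fun_eq_iff imem ri simp del: One_nat_def)
    have "bij_betw (\<tau> \<circ> ?r) I {1..?k}"
      using bij' permutes_imp_bij[OF \<tau>] by (rule bij_betw_trans)
    then have "bij_betw (restrict (\<tau> \<circ> ?r) I) I {1..?k}"
      by (simp cong: bij_betw_cong)
    then show "restrict (\<tau> \<circ> ?r) I \<in> labelings I"
      unfolding labelings_def by (auto simp: bij_betw_def)
    show "config_weight r n I (t \<circ> restrict (\<tau> \<circ> ?r) I) z = config_weight r n I (\<lambda>i. t (\<tau> (?r i))) z"
      by (rule config_weight_cong) simp
  next
    fix \<beta> assume "\<beta> \<in> labelings I"
    then have \<beta>: "\<beta> \<in> extensional I" "bij_betw \<beta> I {1..?k}"
      by (auto simp: labelings_def PiE_def)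
    show "restrict ((\<lambda>a. if a \<in> {1..?k} then \<beta> (?i a) else a) \<circ> ?r) I = \<beta>"
      using \<beta>(1) rmem by (intro extensionalityI) (auto simp: ir simp del: One_nat_def)
    have "bij_betw (\<beta> \<circ> ?i) {1..?k} {1..?k}" using bij \<beta>(2) by (rule bij_betw_trans)
    then have "bij_betw (\<lambda>a. if a \<in> {1..?k} then \<beta> (?i a) else a) {1..?k} {1..?k}"
      by (rule bij_betw_cong[THEN iffD1, rotated]) auto
    then show "(\<lambda>a. if a \<in> {1..?k} then \<beta> (?i a) else a) \<in> {\<tau>. \<tau> permutes {1..?k}}"
      by (auto intro: bij_imp_permutes)
  qed
  then show ?thesis
    by (simp add: W_fun_def Sym_def U_fun_eq[OF assms] core_weight_def flip: sum_distrib_left)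
qed

section \<open>Exchange relations for adjacent transpositions\<close>

text \<open>An adjacent transposition keeps the order of every pair of sites other than
  \<open>(a, Suc a)\<close>. This confines all later computations to these two sites.\<close>

lemma prod_ordered_pairs_transpose:
  fixes a :: nat
  defines "s \<equiv> transpose a (Suc a)"
  shows "(\<Prod>(i, j)\<in>ordered_pairs I - {(a, Suc a)}. f (s i) (s j)) =
    (\<Prod>(i, j)\<in>ordered_pairs (s ` I) - {(a, Suc a)}. f i j)"
proof -
  have mono: "s i < s j \<and> (s i, s j) \<noteq> (a, Suc a)" if "i < j" "(i, j) \<noteq> (a, Suc a)" for i j
    using that unfolding s_def transpose_def by (auto split: if_splits)
  show ?thesis
    by (rule prod.reindex_bij_witness[where i = "map_prod s s" and j = "map_prod s s"])
      (use mono in \<open>auto simp: ordered_pairs_def s_def in_transpose_image_iff transpose_eq_iff\<close>)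
qed

lemma finite_ordered_pairs [simp]: "finite I \<Longrightarrow> finite (ordered_pairs I)"
  by (rule finite_subset[of _ "I \<times> I"]) (auto simp: ordered_pairs_def)

text \<open>Only the factor of the pair \<open>(a, Suc a)\<close> changes. For the kinds 01 and 11
  it goes from \<open>hbar + \<zeta>\<close> to \<open>hbar - \<zeta>\<close>, and their quotient is
  \<open>R_alpha\<close>; for the other two kinds both prefactor and \<open>R_alpha\<close> are
  1.\<close>

lemma prefactor_transpose:
  assumes "a \<in> {1..<n}" "hbar - (z (Suc a) - z a) \<noteq> 0"
  shows "prefactor r n z =
    R_alpha r (z (Suc a) - z a) * prefactor r n (z \<circ> transpose a (Suc a))"
proof -
  let ?s = "transpose a (Suc a)" and ?w = "\<lambda>z a b. z b - z a + hbar"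
  let ?rest = "\<Prod>(i, j)\<in>ordered_pairs {1..n} - {(a, Suc a)}. ?w z i j"
  have mem: "(a, Suc a) \<in> ordered_pairs {1..n}" using assms(1) by (auto simp: ordered_pairs_def)
  have "?s ` {1..n} = {1..n}" using assms(1) by (intro transpose_image_eq) auto
  then have rest: "(\<Prod>(i, j)\<in>ordered_pairs {1..n} - {(a, Suc a)}. ?w (z \<circ> ?s) i j) = ?rest"
    using prod_ordered_pairs_transpose[where f = "?w z" and I = "{1..n}" and a = a] by (simp add: comp_def)
  have A: "(\<Prod>(i, j)\<in>ordered_pairs {1..n}. ?w z i j) = ?w z a (Suc a) * ?rest"
    by (subst prod.remove[OF _ mem]) auto
  have B: "(\<Prod>(i, j)\<in>ordered_pairs {1..n}. ?w (z \<circ> ?s) i j) = ?w z (Suc a) a * ?rest"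
    by (subst prod.remove[OF _ mem]) (auto simp: rest[unfolded comp_def One_nat_def])
  \<comment> \<open>Stated for free variables, so that the long products remain atoms in the
    polynomial arithmetic.\<close>
  have "(hbar - (q - p)) * A = (hbar + (q - p)) * B"
    if "A = (q - p + hbar) * R" "B = (p - q + hbar) * R" for p q A B R :: ratfun
    using that by algebra
  from this[OF A B] have "(hbar - (z (Suc a) - z a)) * (\<Prod>(i, j)\<in>ordered_pairs {1..n}. ?w z i j) =
      (hbar + (z (Suc a) - z a)) * (\<Prod>(i, j)\<in>ordered_pairs {1..n}. ?w (z \<circ> ?s) i j)" .
  moreover have "A = p / q * B" if "q * A = p * B" "q \<noteq> 0" for p q A B :: ratfun
    using that by (simp add: field_simps)
  ultimately have "(\<Prod>(i, j)\<in>ordered_pairs {1..n}. ?w z i j) =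
      (hbar + (z (Suc a) - z a)) / (hbar - (z (Suc a) - z a)) *
      (\<Prod>(i, j)\<in>ordered_pairs {1..n}. ?w (z \<circ> ?s) i j)"
    using assms(2) by blast
  then show ?thesis
    using assms(2) by (cases r) (simp_all only: prefactor_def R_alpha_def kind.case mult_1)
qed

section \<open>One or two particles on a pair of adjacent sites\<close>

definition shared_factor :: "kind \<Rightarrow> nat \<Rightarrow> nat \<Rightarrow> ratfun \<Rightarrow> (nat \<Rightarrow> ratfun) \<Rightarrow> ratfun" where
  "shared_factor r n a t z = mass r * common_factor r t (z a) * common_factor r t (z (Suc a)) *
     (\<Prod>b\<in>{1..n} - {a, Suc a}. site_factor r a b t (z b))"

lemma particle_factor_at:
  assumes "a \<in> {1..<n}"
  shows "particle_factor r n i t z = mass r * (site_factor r i a t (z a) *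
    site_factor r i (Suc a) t (z (Suc a))) * (\<Prod>b\<in>{1..n} - {a, Suc a}. site_factor r i b t (z b))"
proof -
  have "{1..n} = insert a (insert (Suc a) ({1..n} - {a, Suc a}))" using assms by auto
  then have "(\<Prod>b=1..n. site_factor r i b t (z b)) =
      (\<Prod>b\<in>insert a (insert (Suc a) ({1..n} - {a, Suc a})). site_factor r i b t (z b))" by simp
  also have "\<dots> = site_factor r i a t (z a) * (site_factor r i (Suc a) t (z (Suc a)) *
      (\<Prod>b\<in>{1..n} - {a, Suc a}. site_factor r i b t (z b)))"
    by (subst prod.insert; (simp)?)+
  finally show ?thesis by (simp add: particle_factor_def mult_ac)
qed

lemma prod_site_factor_transpose:
  "(\<Prod>b\<in>{1..n} - {a, Suc a}. site_factor r i b t ((z \<circ> transpose a (Suc a)) b)) =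
   (\<Prod>b\<in>{1..n} - {a, Suc a}. site_factor r i b t (z b))"
  by (intro prod.cong) auto

lemma particle_factor_transpose_other:
  assumes "a \<in> {1..<n}" "i \<notin> {a, Suc a}"
  shows "particle_factor r n i t (z \<circ> transpose a (Suc a)) = particle_factor r n i t z"
  unfolding particle_factor_at[OF assms(1)] prod_site_factor_transpose
  using assms(2) by (auto simp: site_factor_def)

lemma shared_factor_transpose:
  "shared_factor r n a t (z \<circ> transpose a (Suc a)) = shared_factor r n a t z"
  unfolding shared_factor_def prod_site_factor_transpose by simp

text \<open>All sites other than \<open>a\<close> and \<open>Suc a\<close> lie on the same side of
  both, so their factors do not tell where the particle sits. What is left is the factor of the
  other one of the two sites.\<close>

lemma particle_factor_left:
  assumes "a \<in> {1..<n}"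
  shows "particle_factor r n a t z = shared_factor r n a t z * (z (Suc a) - t)"
  unfolding particle_factor_at[OF assms] shared_factor_def by (simp add: site_factor_def)

lemma particle_factor_right:
  assumes "a \<in> {1..<n}"
  shows "particle_factor r n (Suc a) t z = shared_factor r n a t z * lower_factor r t (z a)"
proof -
  have "(\<Prod>b\<in>{1..n} - {a, Suc a}. site_factor r (Suc a) b t (z b)) =
      (\<Prod>b\<in>{1..n} - {a, Suc a}. site_factor r a b t (z b))"
    by (intro prod.cong) (auto simp: site_factor_def)
  then show ?thesis
    unfolding particle_factor_at[OF assms] shared_factor_def by (simp add: site_factor_def)
qed

text \<open>Without the shared factor, a particle at \<open>a\<close> contributes
  \<open>z (Suc a) - t\<close> and one at \<open>Suc a\<close> contributes the lower factor of
  \<open>z a\<close>. The claim becomes two identities that are linear in \<open>t\<close> once the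
  denominator is cleared.\<close>

lemma particle_factor_exchange:
  fixes z :: "nat \<Rightarrow> ratfun" and a :: nat
  defines "\<zeta> \<equiv> z (Suc a) - z a" and "s \<equiv> transpose a (Suc a)"
  assumes "a \<in> {1..<n}" "hbar - \<zeta> \<noteq> 0" "i \<in> {a, Suc a}"
  shows "R_alpha r \<zeta> * particle_factor r n i t z =
    \<zeta> / (hbar - \<zeta>) * particle_factor r n (s i) t (z \<circ> s) +
    hbar / (hbar - \<zeta>) * particle_factor r n i t (z \<circ> s)"
proof -
  have "R_alpha r \<zeta> * (z (Suc a) - t) =
      \<zeta> / (hbar - \<zeta>) * lower_factor r t (z (Suc a)) + hbar / (hbar - \<zeta>) * (z a - t)"
    using assms(4) by (cases r)
      (simp_all add: R_alpha_def lower_factor_def flip: add_divide_distrib,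
       simp_all add: field_simps \<zeta>_def)
  moreover have "R_alpha r \<zeta> * lower_factor r t (z a) =
      \<zeta> / (hbar - \<zeta>) * (z a - t) + hbar / (hbar - \<zeta>) * lower_factor r t (z (Suc a))"
    using assms(4) by (cases r)
      (simp_all add: R_alpha_def lower_factor_def flip: add_divide_distrib,
       simp_all add: field_simps \<zeta>_def)
  moreover have "R * (h * X) = p * (h * L) + q * (h * M)" if "R * X = p * L + q * M"
    for R h X p L q M :: ratfun
    using that by algebra
  ultimately show ?thesis
    using assms(5) particle_factor_left[OF assms(3), of r t] particle_factor_right[OF assms(3), of r t]
    by (elim insertE emptyE) (simp_all only: s_def shared_factor_transpose comp_apply
      transpose_apply_first transpose_apply_second)
qed

text \<open>\<open>L x y\<close> is the symmetrised contribution of two particles on both sites. For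
  the kinds 10 and 01 the variables \<open>t\<close> and \<open>u\<close> cancel, leaving
  \<open>y - x + hbar\<close> and \<open>x - y + hbar\<close> respectively; this produces the
  entries \<open>(hbar + \<zeta>) / (hbar - \<zeta>)\<close>. For the kinds 00 and 11,
  \<open>L\<close> is symmetric in \<open>x\<close> and \<open>y\<close>, in accordance with
  \<open>R_alpha = R_beta\<close>.\<close>

lemma pair_exchange:
  fixes x y t u :: ratfun and r :: kind
  assumes "hbar - (y - x) \<noteq> 0" "u - t \<noteq> 0" "u - t + hbar \<noteq> 0" "t - u + hbar \<noteq> 0"
  defines "L \<equiv> \<lambda>x y. (y - t) * lower_factor r u x * pair_factor r t u +
    (y - u) * lower_factor r t x * pair_factor r u t"
  shows "R_alpha r (y - x) * L x y = R_beta r (y - x) * L y x"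
proof -
  \<comment> \<open>The reciprocals become new variables subject to their defining relations, so
    each identity is a question of membership in a polynomial ideal.\<close>
  define g e f k where "g = 1 / (u - t)" and "e = 1 / (u - t + hbar)" and "f = 1 / (t - u + hbar)"
    and "k = 1 / (hbar - (y - x))"
  have inv: "g * (u - t) = 1" "e * (u - t + hbar) = 1" "f * (t - u + hbar) = 1"
    "k * (hbar - (y - x)) = 1"
    using assms by (simp_all add: g_def e_def f_def k_def)
  have g': "1 / (t - u) = - g"
    unfolding g_def by (metis minus_diff_eq minus_divide_right)
  have mult: "1 / (p * q) = (1 / p) * (1 / q)" "p / q = p * (1 / q)" for p q :: ratfun by simp_all
  have e00: "(y - t) * (u - x + hbar) * (e * g) + (y - u) * (t - x + hbar) * (f * - g) =
    (x - t) * (u - y + hbar) * (e * g) + (x - u) * (t - y + hbar) * (f * - g)"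
    using inv by algebra
  have e10: "(y - t) * (u - x + hbar) * g + (y - u) * (t - x + hbar) * - g =
    ((hbar + (y - x)) * k) * ((x - t) * (u - y + hbar) * g + (x - u) * (t - y + hbar) * - g)"
    using inv by algebra
  have e01: "((hbar + (y - x)) * k) * ((y - t) * (x - u + hbar) * g + (y - u) * (x - t + hbar) * - g) =
    (x - t) * (y - u + hbar) * g + (x - u) * (y - t + hbar) * - g"
    using inv by algebra
  have e11: "(y - t) * (x - u + hbar) * ((u - t + hbar) * g) + (y - u) * (x - t + hbar) * ((t - u + hbar) * - g) =
    (x - t) * (y - u + hbar) * ((u - t + hbar) * g) + (x - u) * (y - t + hbar) * ((t - u + hbar) * - g)"
    by (simp add: algebra_simps)
  show ?thesis
  proof (cases r)
    case K00 then show ?thesis using e00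
      by (simp add: L_def R_alpha_def R_beta_def lower_factor_def pair_factor_def mult(1) g' flip: g_def e_def f_def)
  next
    case K10 then show ?thesis using e10
      by (simp add: L_def R_alpha_def R_beta_def lower_factor_def pair_factor_def g' mult(2)[of "_ + _"] flip: g_def k_def)
  next
    case K01 then show ?thesis using e01
      by (simp add: L_def R_alpha_def R_beta_def lower_factor_def pair_factor_def g' mult(2)[of "_ + _"] flip: g_def k_def)
  next
    case K11 then show ?thesis using e11
      by (simp add: L_def R_alpha_def R_beta_def lower_factor_def pair_factor_def g' mult(2)[of "_ + _"] flip: g_def k_def)
  qed
qed

lemma particle_pair_exchange:
  fixes z :: "nat \<Rightarrow> ratfun" and a n :: nat and r :: kind and t u :: ratfun
  defines "\<zeta> \<equiv> z (Suc a) - z a" and "s \<equiv> transpose a (Suc a)"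
  assumes "a \<in> {1..<n}" "hbar - \<zeta> \<noteq> 0" "u - t \<noteq> 0" "u - t + hbar \<noteq> 0" "t - u + hbar \<noteq> 0"
  defines "S \<equiv> \<lambda>z. particle_factor r n a t z * particle_factor r n (Suc a) u z * pair_factor r t u +
    particle_factor r n a u z * particle_factor r n (Suc a) t z * pair_factor r u t"
  shows "R_alpha r \<zeta> * S z = R_beta r \<zeta> * S (z \<circ> s)"
proof -
  define L where "L = (\<lambda>x y. (y - t) * lower_factor r u x * pair_factor r t u +
    (y - u) * lower_factor r t x * pair_factor r u t)"
  let ?h = "shared_factor r n a t z * shared_factor r n a u z"
  have S: "S z = ?h * L (z a) (z (Suc a))" "S (z \<circ> s) = ?h * L (z (Suc a)) (z a)"
    unfolding S_def particle_factor_left[OF assms(3)] particle_factor_right[OF assms(3)] s_def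
      shared_factor_transpose L_def by (simp_all add: algebra_simps)
  have "R_alpha r \<zeta> * L (z a) (z (Suc a)) = R_beta r \<zeta> * L (z (Suc a)) (z a)"
    unfolding L_def \<zeta>_def using assms(4-7) by (intro pair_exchange) (simp_all add: \<zeta>_def)
  then show ?thesis unfolding S by (simp add: mult.left_commute)
qed

section \<open>Exchange relations summed over labelings\<close>

lemma core_weight_transpose:
  fixes a b :: nat
  defines "s \<equiv> transpose a b"
  shows "core_weight r n (s ` I) t z = (\<Sum>\<beta>\<in>labelings I. config_weight r n (s ` I) (t \<circ> \<beta> \<circ> s) z)"
proof -
  have card: "card (s ` I) = card I" for I by (simp add: card_image s_def)
  \<comment> \<open>The label travels with its particle: composing with \<open>s\<close> carries
    labelings of \<open>I\<close> to labelings of its image, and is its own inverse.\<close>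
  have mem: "\<beta> \<circ> s \<in> labelings (s ` I)" if "\<beta> \<in> labelings I" for \<beta> I
  proof -
    have \<beta>: "\<beta> \<in> extensional I" "bij_betw \<beta> I {1..card I}"
      using that by (auto simp: labelings_def PiE_def)
    have "bij_betw s (s ` I) I"
      by (auto simp: s_def bij_betw_def image_image)
    then have bij: "bij_betw (\<beta> \<circ> s) (s ` I) {1..card (s ` I)}"
      using \<beta>(2) unfolding card by (rule bij_betw_trans)
    have "\<beta> \<circ> s \<in> extensional (s ` I)"
      using \<beta>(1) by (auto simp: extensional_def s_def in_transpose_image_iff)
    with bij show ?thesis by (auto simp: labelings_def PiE_def bij_betw_def)
  qed
  have ss: "s \<circ> s = id" by (simp add: s_def)
  have "s ` s ` I = I" for I by (simp add: image_image s_def)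
  then show ?thesis
    unfolding core_weight_def
    using mem[of _ "s ` I"] mem[of _ I]
    by (intro sum.reindex_bij_witness[where i = "\<lambda>\<beta>. \<beta> \<circ> s" and j = "\<lambda>\<beta>. \<beta> \<circ> s"])
      (simp_all add: ss comp_assoc)
qed

text \<open>With one particle on the two sites the relation holds for each labeling separately. The
  other particles are insensitive to exchanging \<open>z a\<close> and \<open>z (Suc a)\<close>, and
  the pair factors do not change when the particle moves to the neighbouring empty site with its
  label, because it passes no other particle.\<close>

lemma config_weight_exchange_single:
  fixes z :: "nat \<Rightarrow> ratfun" and a :: nat
  defines "\<zeta> \<equiv> z (Suc a) - z a" and "s \<equiv> transpose a (Suc a)"
  assumes "a \<in> {1..<n}" "hbar - \<zeta> \<noteq> 0" "finite I" "i \<in> {a, Suc a}" "i \<in> I" "s i \<notin> I"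
  shows "R_alpha r \<zeta> * config_weight r n I x z =
    \<zeta> / (hbar - \<zeta>) * config_weight r n (s ` I) (x \<circ> s) (z \<circ> s) +
    hbar / (hbar - \<zeta>) * config_weight r n I x (z \<circ> s)"
proof -
  let ?P = "particle_factor r n"
  define E where "E = (\<Prod>(k, l)\<in>ordered_pairs I. pair_factor r (x k) (x l))"
  define Q where "Q = (\<Prod>l\<in>I - {i}. ?P l (x l) z)"
  have other: "l \<notin> {a, Suc a}" if "l \<in> I - {i}" for l
    using assms(6-8) that by (auto simp: s_def)
  have notin: "(a, Suc a) \<notin> ordered_pairs I" "(a, Suc a) \<notin> ordered_pairs (s ` I)"
    using assms(6-8) by (auto simp: ordered_pairs_def s_def in_transpose_image_iff)
  have E': "(\<Prod>(k, l)\<in>ordered_pairs (s ` I). pair_factor r ((x \<circ> s) k) ((x \<circ> s) l)) = E"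
    using prod_ordered_pairs_transpose[of "\<lambda>k l. pair_factor r (x (s k)) (x (s l))" a I] notin
    by (simp add: E_def s_def)
  have split: "(\<Prod>l\<in>I. f l) = f i * (\<Prod>l\<in>I - {i}. f l)" for f :: "nat \<Rightarrow> ratfun"
    using assms(5,7) by (rule prod.remove)
  have c1: "config_weight r n I x z = ?P i (x i) z * (Q * E)"
    unfolding config_weight_def E_def[symmetric] split Q_def by simp
  have Q': "(\<Prod>l\<in>I - {i}. ?P l (x l) (z \<circ> s)) = Q" "(\<Prod>l\<in>I - {i}. ?P (s l) (x l) (z \<circ> s)) = Q"
    unfolding Q_def s_def using other
    by (auto intro!: prod.cong simp: particle_factor_transpose_other[OF assms(3)])
  have c2: "config_weight r n I x (z \<circ> s) = ?P i (x i) (z \<circ> s) * (Q * E)"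
    unfolding config_weight_def E_def[symmetric] split Q' by simp
  have "(\<Prod>l\<in>s ` I. ?P l ((x \<circ> s) l) (z \<circ> s)) = (\<Prod>l\<in>I. ?P (s l) (x l) (z \<circ> s))"
    by (subst prod.reindex) (simp_all add: s_def)
  then have c3: "config_weight r n (s ` I) (x \<circ> s) (z \<circ> s) = ?P (s i) (x i) (z \<circ> s) * (Q * E)"
    unfolding config_weight_def E' split Q' by simp
  have "R * (f * h) = p * (g * h) + q * (k * h)" if "R * f = p * g + q * k" for R f h p g q k :: ratfun
    using that by algebra
  from this[OF particle_factor_exchange[where z = z, OF assms(3) assms(4)[unfolded \<zeta>_def] assms(6)]]
  show ?thesis unfolding c1 c2 c3 unfolding \<zeta>_def s_def .
qed

lemma core_weight_exchange_single:
  fixes z :: "nat \<Rightarrow> ratfun" and a :: nat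
  defines "\<zeta> \<equiv> z (Suc a) - z a" and "s \<equiv> transpose a (Suc a)"
  assumes "a \<in> {1..<n}" "hbar - \<zeta> \<noteq> 0" "finite I" "i \<in> {a, Suc a}" "i \<in> I" "s i \<notin> I"
  shows "R_alpha r \<zeta> * core_weight r n I t z =
    \<zeta> / (hbar - \<zeta>) * core_weight r n (s ` I) t (z \<circ> s) +
    hbar / (hbar - \<zeta>) * core_weight r n I t (z \<circ> s)"
  using config_weight_exchange_single[where z = z, OF assms(3) assms(4)[unfolded \<zeta>_def] assms(5-7)
    assms(8)[unfolded s_def], of r "t \<circ> _"]
  unfolding s_def core_weight_transpose unfolding core_weight_def sum_distrib_left \<zeta>_def
  by (simp add: sum.distrib)

text \<open>Adding the configuration with the variables at \<open>a\<close> and \<open>Suc a\<close>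
  interchanged produces the symmetrised two-particle factor; all remaining factors are common to the
  four terms.\<close>

lemma config_weight_exchange_pair:
  fixes z :: "nat \<Rightarrow> ratfun" and a n :: nat and r :: kind and I :: "nat set"
  defines "\<zeta> \<equiv> z (Suc a) - z a" and "s \<equiv> transpose a (Suc a)"
  assumes "a \<in> {1..<n}" "hbar - \<zeta> \<noteq> 0" "finite I" "a \<in> I" "Suc a \<in> I"
    "x (Suc a) - x a \<noteq> 0" "x (Suc a) - x a + hbar \<noteq> 0" "x a - x (Suc a) + hbar \<noteq> 0"
  defines "S \<equiv> \<lambda>z. config_weight r n I x z + config_weight r n I (x \<circ> s) z"
  shows "R_alpha r \<zeta> * S z = R_beta r \<zeta> * S (z \<circ> s)"
proof -
  let ?P = "particle_factor r n" and ?w = "pair_factor r"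
  define E where "E = (\<Prod>(k, l)\<in>ordered_pairs I - {(a, Suc a)}. ?w (x k) (x l))"
  define Q where "Q = (\<Prod>l\<in>I - {a, Suc a}. ?P l (x l) z)"
  have mem: "(a, Suc a) \<in> ordered_pairs I" using assms(6,7) by (auto simp: ordered_pairs_def)
  have "s ` I = I" unfolding s_def using assms(6,7) by (intro transpose_image_eq) simp
  then have E': "(\<Prod>(k, l)\<in>ordered_pairs I - {(a, Suc a)}. ?w ((x \<circ> s) k) ((x \<circ> s) l)) = E"
    using prod_ordered_pairs_transpose[of "\<lambda>k l. ?w (x k) (x l)" a I]
    by (simp add: E_def s_def)
  have c: "config_weight r n I y z = (?P a (y a) z * ?P (Suc a) (y (Suc a)) z * ?w (y a) (y (Suc a))) *
     ((\<Prod>l\<in>I - {a, Suc a}. ?P l (y l) z) *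
      (\<Prod>(k, l)\<in>ordered_pairs I - {(a, Suc a)}. ?w (y k) (y l)))" for y z
  proof -
    have "I = insert a (insert (Suc a) (I - {a, Suc a}))" using assms(6,7) by auto
    then have "(\<Prod>l\<in>I. ?P l (y l) z) = (\<Prod>l\<in>insert a (insert (Suc a) (I - {a, Suc a})). ?P l (y l) z)"
      by simp
    also have "\<dots> = ?P a (y a) z * ?P (Suc a) (y (Suc a)) z * (\<Prod>l\<in>I - {a, Suc a}. ?P l (y l) z)"
      using assms(5) by simp
    finally show ?thesis
      unfolding config_weight_def
      using prod.remove[OF finite_ordered_pairs[OF assms(5)] mem, of "\<lambda>(k, l). ?w (y k) (y l)"] by simp
  qed
  have Q': "(\<Prod>l\<in>I - {a, Suc a}. ?P l ((x \<circ> s) l) z) = Q"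
    "(\<Prod>l\<in>I - {a, Suc a}. ?P l (x l) (z \<circ> s)) = Q"
    "(\<Prod>l\<in>I - {a, Suc a}. ?P l ((x \<circ> s) l) (z \<circ> s)) = Q"
    unfolding Q_def s_def
    by (auto intro!: prod.cong simp: particle_factor_transpose_other[OF assms(3)])
  let ?S = "\<lambda>z. ?P a (x a) z * ?P (Suc a) (x (Suc a)) z * ?w (x a) (x (Suc a)) +
    ?P a (x (Suc a)) z * ?P (Suc a) (x a) z * ?w (x (Suc a)) (x a)"
  have "S z = ?S z * (Q * E)" "S (z \<circ> s) = ?S (z \<circ> s) * (Q * E)"
    unfolding S_def c Q' E' E_def[symmetric] Q_def[symmetric] by (simp_all add: s_def distrib_right)
  moreover have "R_alpha r \<zeta> * ?S z = R_beta r \<zeta> * ?S (z \<circ> s)"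
    using particle_pair_exchange[where z = z, OF assms(3) assms(4)[unfolded \<zeta>_def] assms(8-10)]
    unfolding \<zeta>_def s_def .
  ultimately show ?thesis by (simp only: mult.assoc[symmetric])
qed

text \<open>Serves to undo the double counting of labelings when both sites are occupied.\<close>

lemma two_ne_0: "(2 :: ratfun) \<noteq> 0"
proof -
  have "to_fract (1 + 1 :: mpoly) = 1 + 1" by (simp only: to_fract_add to_fract_1)
  then have "(2 :: ratfun) = to_fract (1 + 1)" by (simp only: one_add_one)
  moreover have "(1 + 1 :: mpoly) = Poly_Mapping.single 0 2"
    by (simp only: one_add_one single_numeral)
  moreover have "Poly_Mapping.single 0 2 \<noteq> (0 :: mpoly)"
    by (metis lookup_single_eq lookup_zero zero_neq_numeral)
  ultimately show ?thesis by (simp only: to_fract_eq_0_iff not_False_eq_True)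
qed

text \<open>For the \<open>t\<close> variables this keeps the denominators of
  \<open>pair_factor\<close> nonzero; for the \<open>z\<close> variables it keeps the diagonal
  values of the weights nonzero.\<close>

definition generic_points :: "nat \<Rightarrow> (nat \<Rightarrow> ratfun) \<Rightarrow> bool" where
  "generic_points k t \<longleftrightarrow> (\<forall>i\<in>{1..k}. \<forall>j\<in>{1..k}. i \<noteq> j \<longrightarrow> t j - t i \<noteq> 0 \<and> t j - t i + hbar \<noteq> 0)"

lemma core_weight_exchange_pair:
  fixes z :: "nat \<Rightarrow> ratfun" and a :: nat
  defines "\<zeta> \<equiv> z (Suc a) - z a" and "s \<equiv> transpose a (Suc a)"
  assumes "a \<in> {1..<n}" "hbar - \<zeta> \<noteq> 0" "finite I" "a \<in> I" "Suc a \<in> I" "generic_points (card I) t"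
  shows "R_alpha r \<zeta> * core_weight r n I t z = R_beta r \<zeta> * core_weight r n I t (z \<circ> s)"
proof -
  let ?S = "\<lambda>z \<beta>. config_weight r n I (t \<circ> \<beta>) z + config_weight r n I (t \<circ> \<beta> \<circ> s) z"
  have "s ` I = I" unfolding s_def using assms(6,7) by (intro transpose_image_eq) simp
  \<comment> \<open>As \<open>s\<close> maps \<open>I\<close> to itself, every labeling occurs once
    as \<beta> and once as \<open>\<beta> \<circ> s\<close>.\<close>
  then have "2 * core_weight r n I t z = (\<Sum>\<beta>\<in>labelings I. ?S z \<beta>)" for z
    using core_weight_transpose[of r n a "Suc a" I t z]
    by (simp add: s_def sum.distrib) (simp add: core_weight_def)
  moreover have "R_alpha r \<zeta> * ?S z \<beta> = R_beta r \<zeta> * ?S (z \<circ> s) \<beta>" if "\<beta> \<in> labelings I" for \<beta>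
  proof -
    have "\<beta> a \<in> {1..card I}" "\<beta> (Suc a) \<in> {1..card I}" "\<beta> a \<noteq> \<beta> (Suc a)"
      using that assms(6,7) by (auto simp: labelings_def bij_betw_def dest: inj_onD)
    then show ?thesis
      using assms(8) unfolding \<zeta>_def s_def generic_points_def
      by (intro config_weight_exchange_pair assms(3-7)[unfolded \<zeta>_def]) auto
  qed
  ultimately have "R_alpha r \<zeta> * (2 * core_weight r n I t z) =
      R_beta r \<zeta> * (2 * core_weight r n I t (z \<circ> s))"
    by (simp add: sum_distrib_left)
  then show ?thesis using two_ne_0 by simp
qed

lemma core_weight_exchange_none:
  fixes z :: "nat \<Rightarrow> ratfun" and a :: nat
  assumes "a \<in> {1..<n}" "a \<notin> I" "Suc a \<notin> I"
  shows "core_weight r n I t (z \<circ> transpose a (Suc a)) = core_weight r n I t z"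
  unfolding core_weight_def config_weight_def using assms(2,3)
  by (intro sum.cong arg_cong2[where f = "(*)"] prod.cong refl particle_factor_transpose_other[OF assms(1)])
    auto

text \<open>The factor \<open>R_alpha\<close> released by the prefactor meets the left sides of the
  relations for \<open>core_weight\<close>. It survives if both sites are empty, turns into
  \<open>R_beta\<close> if both are occupied, and is absorbed into the middle block of the R-matrix
  if exactly one is.\<close>

lemma W_fun_exchange:
  fixes z :: "nat \<Rightarrow> ratfun" and a :: nat
  defines "\<zeta> \<equiv> z (Suc a) - z a" and "s \<equiv> transpose a (Suc a)"
  assumes "a \<in> {1..<n}" "hbar - \<zeta> \<noteq> 0" "I \<subseteq> {1..n}"
  shows "a \<notin> I \<Longrightarrow> Suc a \<notin> I \<Longrightarrow> W_fun r n I t z = R_alpha r \<zeta> * W_fun r n I t (z \<circ> s)"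
    and "a \<in> I \<Longrightarrow> Suc a \<in> I \<Longrightarrow> generic_points (card I) t \<Longrightarrow>
      W_fun r n I t z = R_beta r \<zeta> * W_fun r n I t (z \<circ> s)"
    and "i \<in> {a, Suc a} \<Longrightarrow> i \<in> I \<Longrightarrow> s i \<notin> I \<Longrightarrow> W_fun r n I t z =
      \<zeta> / (hbar - \<zeta>) * W_fun r n (s ` I) t (z \<circ> s) + hbar / (hbar - \<zeta>) * W_fun r n I t (z \<circ> s)"
proof -
  have fin: "finite I" using assms(5) finite_subset by blast
  have "s ` {1..n} = {1..n}" unfolding s_def using assms(3) by (intro transpose_image_eq) auto
  then have sI: "s ` I \<subseteq> {1..n}" using assms(5) by blast
  note pre = prefactor_transpose[where z = z, OF assms(3) assms(4)[unfolded \<zeta>_def], of r, folded \<zeta>_def s_def]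
  note W = W_fun_eq[OF assms(5)] W_fun_eq[OF sI]
  show "W_fun r n I t z = R_alpha r \<zeta> * W_fun r n I t (z \<circ> s)" if "a \<notin> I" "Suc a \<notin> I"
    unfolding W pre using core_weight_exchange_none[OF assms(3) that] by (simp add: s_def)
  show "W_fun r n I t z = R_beta r \<zeta> * W_fun r n I t (z \<circ> s)"
    if "a \<in> I" "Suc a \<in> I" "generic_points (card I) t"
    using core_weight_exchange_pair[where z = z, OF assms(3) assms(4)[unfolded \<zeta>_def] fin that, of r,
      folded \<zeta>_def s_def]
    unfolding W pre by algebra
  show "W_fun r n I t z =
      \<zeta> / (hbar - \<zeta>) * W_fun r n (s ` I) t (z \<circ> s) + hbar / (hbar - \<zeta>) * W_fun r n I t (z \<circ> s)"
    if "i \<in> {a, Suc a}" "i \<in> I" "s i \<notin> I"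
  proof -
    have "R * P * c = p * (P * d) + q * (P * e)" if "R * c = p * d + q * e" for R P c p d q e :: ratfun
      using that by algebra
    from this[OF core_weight_exchange_single[where z = z, OF assms(3) assms(4)[unfolded \<zeta>_def] fin
      that(1,2) that(3)[unfolded s_def]]]
    show ?thesis unfolding W pre unfolding \<zeta>_def s_def .
  qed
qed

section \<open>Triangularity under the specialisation of t to z\<close>

lemma generic_pointsD:
  assumes "generic_points k t" "i \<in> {1..k}" "j \<in> {1..k}" "i \<noteq> j"
  shows "t j - t i \<noteq> 0" "t j - t i + hbar \<noteq> 0"
  using assms unfolding generic_points_def by blast+

text \<open>The hypotheses cover the denominators in the \<open>t\<close> variables:
  \<open>generic_points\<close> those of the pair factors, the last one those of the common factors.
  The latter tolerates \<open>v (T i) = z b\<close>, where the denominator is just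
  \<open>hbar\<close>.\<close>

lemma specialises_W_fun:
  assumes I: "I \<subseteq> {1..n}" and hbar: "v Hbar = hbar"
    and z: "\<And>b. b \<in> {1..n} \<Longrightarrow> specialises v (z b) (z b)"
    and x: "generic_points (card I) (\<lambda>i. v (T i))"
    and zx: "\<And>b i. b \<in> {1..n} \<Longrightarrow> i \<in> {1..card I} \<Longrightarrow> z b - v (T i) + hbar \<noteq> 0"
  shows "specialises v (W_fun r n I (\<lambda>i. var (T i)) z) (W_fun r n I (\<lambda>i. v (T i)) z)"
proof -
  have h: "specialises v hbar hbar" using specialises_var[of v Hbar] hbar by simp
  note intros = specialises_add specialises_diff specialises_mult specialises_divide specialises_1
    specialises_var h
  have pre: "specialises v (prefactor r n z) (prefactor r n z)"
    unfolding prefactor_def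
    by (cases r) (auto intro!: intros specialises_prod z simp: ordered_pairs_def)
  have mass: "specialises v (mass r) (mass r)"
    unfolding mass_def by (cases r) (auto intro!: intros)
  have site: "specialises v (site_factor r i b (var (T a)) (z b)) (site_factor r i b (v (T a)) (z b))"
    if "b \<in> {1..n}" "a \<in> {1..card I}" for i b a
  proof -
    note zb = z[OF that(1)] zx[OF that]
    have "specialises v (lower_factor r (var (T a)) (z b)) (lower_factor r (v (T a)) (z b))"
      unfolding lower_factor_def by (cases r; simp only: kind.case; intro intros zb)
    moreover have "specialises v (common_factor r (var (T a)) (z b)) (common_factor r (v (T a)) (z b))"
      unfolding common_factor_def by (cases r; simp only: kind.case; intro intros zb)
    ultimately show ?thesis
      unfolding site_factor_def using zb by (simp add: intros)
  qed
  have pair: "specialises v (pair_factor r (var (T a)) (var (T b))) (pair_factor r (v (T a)) (v (T b)))"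
    if "a \<in> {1..card I}" "b \<in> {1..card I}" "a \<noteq> b" for a b
    unfolding pair_factor_def using generic_pointsD[OF x that] by (cases r) (auto intro!: intros)
  have "specialises v (config_weight r n I ((\<lambda>i. var (T i)) \<circ> \<beta>) z)
      (config_weight r n I ((\<lambda>i. v (T i)) \<circ> \<beta>) z)" if "\<beta> \<in> labelings I" for \<beta>
  proof -
    have mem: "\<beta> i \<in> {1..card I}" if "i \<in> I" for i
      using \<open>\<beta> \<in> labelings I\<close> that by (auto simp: labelings_def)
    have ne: "\<beta> i \<noteq> \<beta> j" if "i \<in> I" "j \<in> I" "i < j" for i j
      using \<open>\<beta> \<in> labelings I\<close> that by (auto simp: labelings_def bij_betw_def dest: inj_onD)
    show ?thesis
      unfolding config_weight_def particle_factor_def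
      using mem ne by (auto intro!: specialises_mult specialises_prod mass site pair simp: ordered_pairs_def
        simp del: One_nat_def atLeastAtMost_iff)
  qed
  then show ?thesis
    unfolding W_fun_eq[OF I] core_weight_def by (intro specialises_mult pre specialises_sum)
qed

section \<open>Values of the weights at points of z\<close>

lemma particle_factor_eq_0:
  assumes "j \<in> {1..n}" "i < j"
  shows "particle_factor r n i (z j) z = 0"
  using assms by (auto simp: particle_factor_def site_factor_def intro!: bexI[of _ j])

lemma particle_factor_ne_0:
  assumes "generic_points n z" "i \<in> {1..n}"
  shows "particle_factor r n i (z i) z \<noteq> 0"
proof -
  have "site_factor r i b (z i) (z b) \<noteq> 0" if "b \<in> {1..n}" for b
  proof (cases "b = i")
    case True
    then show ?thesis using hbar_ne_0 by (cases r) (auto simp: site_factor_def common_factor_def)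
  next
    case False
    with generic_pointsD[OF assms(1,2) that] generic_pointsD[OF assms(1) that assms(2)]
    show ?thesis by (cases r) (auto simp: site_factor_def common_factor_def lower_factor_def)
  qed
  moreover have "mass r \<noteq> 0" using hbar_ne_0 by (cases r) (auto simp: mass_def)
  ultimately show ?thesis by (auto simp: particle_factor_def)
qed

text \<open>A labeling with nonzero contribution gives a bijection \<open>e \<circ> \<beta>\<close>
  from \<open>I\<close> to \<open>J\<close> that increases no element. Hence the elements of
  \<open>J\<close> sum to at most those of \<open>I\<close>; if the sums are also ordered the other
  way, no inequality is strict and the bijection is the identity.\<close>

lemma core_weight_triangular:
  assumes z: "generic_points n z" and I: "I \<subseteq> {1..n}" and J: "J \<subseteq> {1..n}"
    and e: "bij_betw e {1..card I} J"
  shows "core_weight r n I (z \<circ> e) z \<noteq> 0 \<Longrightarrow> \<Sum>I \<le> \<Sum>J \<Longrightarrow> I = J"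
    and "I = J \<Longrightarrow> core_weight r n I (z \<circ> e) z \<noteq> 0"
proof -
  have fin: "finite I" using I finite_subset by blast
  have bij: "bij_betw (e \<circ> \<beta>) I J" if "\<beta> \<in> labelings I" for \<beta>
    using that e by (auto simp: labelings_def intro: bij_betw_trans)
  have le: "(e \<circ> \<beta>) i \<le> i"
    if "config_weight r n I (z \<circ> e \<circ> \<beta>) z \<noteq> 0" "\<beta> \<in> labelings I" "i \<in> I" for \<beta> i
  proof (rule ccontr)
    assume "\<not> (e \<circ> \<beta>) i \<le> i"
    moreover have "(e \<circ> \<beta>) i \<in> {1..n}" using bij_betw_apply[OF bij[OF that(2)] that(3)] J by blast
    ultimately have "particle_factor r n i ((z \<circ> e \<circ> \<beta>) i) z = 0"
      using particle_factor_eq_0[of "(e \<circ> \<beta>) i" n i r z] by simp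
    then have "config_weight r n I (z \<circ> e \<circ> \<beta>) z = 0"
      unfolding config_weight_def using fin that(3) by auto
    with that(1) show False by simp
  qed
  have id: "(e \<circ> \<beta>) i = i"
    if "config_weight r n I (z \<circ> e \<circ> \<beta>) z \<noteq> 0" "\<beta> \<in> labelings I" "\<Sum>I \<le> \<Sum>J" "i \<in> I" for \<beta> i
  proof -
    have "(\<Sum>i\<in>I. (e \<circ> \<beta>) i) = \<Sum>J"
      using sum.reindex_bij_betw[OF bij[OF that(2)], of "\<lambda>i. i"] by simp
    moreover have "(\<Sum>i\<in>I. (e \<circ> \<beta>) i) \<le> (\<Sum>i\<in>I. i)"
      using le[OF that(1,2)] by (rule sum_mono)
    ultimately have "(\<Sum>i\<in>I. (e \<circ> \<beta>) i) = (\<Sum>i\<in>I. i)" using that(3) by simp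
    then show ?thesis using le[OF that(1,2)] that(4) fin by (rule sum_mono_inv)
  qed
  show "I = J" if "core_weight r n I (z \<circ> e) z \<noteq> 0" "\<Sum>I \<le> \<Sum>J"
  proof -
    from that(1) obtain \<beta> where \<beta>: "\<beta> \<in> labelings I" "config_weight r n I (z \<circ> e \<circ> \<beta>) z \<noteq> 0"
      unfolding core_weight_def by (meson sum.neutral)
    have "J = (e \<circ> \<beta>) ` I" using bij[OF \<beta>(1)] by (simp add: bij_betw_def)
    also have "\<dots> = I" using id[OF \<beta>(2,1) that(2)] by simp
    finally show ?thesis by simp
  qed
  show "core_weight r n I (z \<circ> e) z \<noteq> 0" if "I = J"
  proof -
    \<comment> \<open>For \<open>I = J\<close> the surviving labeling must invert \<open>e\<close>,
      so a single term remains and no cancellation can occur.\<close>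
    define \<beta>0 where "\<beta>0 = restrict (inv_into {1..card I} e) I"
    have inv: "bij_betw (inv_into {1..card I} e) I {1..card I}"
      using e that by (simp add: bij_betw_inv_into)
    then have "bij_betw \<beta>0 I {1..card I}" by (simp add: \<beta>0_def cong: bij_betw_cong)
    then have mem: "\<beta>0 \<in> labelings I"
      unfolding labelings_def \<beta>0_def by (auto simp: bij_betw_def)
    have e\<beta>0: "e (\<beta>0 i) = i" if "i \<in> I" for i
      using bij_betw_inv_into_right[OF e] that \<open>I = J\<close> by (simp add: \<beta>0_def)
    have "config_weight r n I (z \<circ> e \<circ> \<beta>) z = 0" if "\<beta> \<in> labelings I - {\<beta>0}" for \<beta>
    proof (rule ccontr)
      assume "config_weight r n I (z \<circ> e \<circ> \<beta>) z \<noteq> 0"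
      then have e\<beta>: "e (\<beta> i) = i" if "i \<in> I" for i
        using id[of \<beta> i] that \<open>\<beta> \<in> _\<close> \<open>I = J\<close> by simp
      have "\<beta> = \<beta>0"
      proof (rule extensionalityI[where A = I])
        show "\<beta> \<in> extensional I" "\<beta>0 \<in> extensional I"
          using that mem by (auto simp: labelings_def PiE_def)
        fix i assume "i \<in> I"
        then have "\<beta> i \<in> {1..card I}" "\<beta>0 i \<in> {1..card I}"
          using that mem by (auto simp: labelings_def)
        then show "\<beta> i = \<beta>0 i"
          using bij_betw_imp_inj_on[OF e] e\<beta>[OF \<open>i \<in> I\<close>] e\<beta>0[OF \<open>i \<in> I\<close>] by (metis inj_onD)
      qed
      with that show False by simp
    qed
    moreover have "finite (I \<rightarrow>\<^sub>E {1..card I})"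
      using fin by (intro finite_PiE) auto
    then have "finite (labelings I)"
      unfolding labelings_def by (rule rev_finite_subset) blast
    ultimately have "core_weight r n I (z \<circ> e) z = config_weight r n I (z \<circ> e \<circ> \<beta>0) z"
      unfolding core_weight_def using mem by (subst sum.remove[of _ \<beta>0]) auto
    also have "\<dots> = config_weight r n I z z"
      by (rule config_weight_cong) (simp add: e\<beta>0)
    also have "\<dots> \<noteq> 0"
    proof -
      have "pair_factor r (z i) (z j) \<noteq> 0" if "(i, j) \<in> ordered_pairs I" for i j
      proof -
        have "i \<in> {1..n}" "j \<in> {1..n}" "i \<noteq> j" using that I by (auto simp: ordered_pairs_def)
        from generic_pointsD[OF z this] show ?thesis by (cases r) (auto simp: pair_factor_def)
      qed
      then show ?thesis
        unfolding config_weight_def using fin I particle_factor_ne_0[OF z, of _ r]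
        by (auto simp: subset_iff)
    qed
    finally show ?thesis .
  qed
qed

lemma prefactor_ne_0:
  assumes "generic_points n z" shows "prefactor r n z \<noteq> 0"
proof -
  have "z b - z a + hbar \<noteq> 0" if "(a, b) \<in> ordered_pairs {1..n}" for a b
    using that generic_pointsD(2)[OF assms] by (auto simp: ordered_pairs_def)
  then show ?thesis by (cases r) (auto simp: prefactor_def)
qed

lemma generic_points_var:
  assumes "inj_on f {1..k}" "Hbar \<notin> f ` {1..k}"
  shows "generic_points k (\<lambda>i. var (f i))"
  unfolding generic_points_def
proof (intro ballI impI)
  fix i j assume "i \<in> {1..k}" "j \<in> {1..k}" "i \<noteq> j"
  then have "f j \<noteq> f i" "f j \<noteq> Hbar" using assms by (metis inj_onD, metis imageI)
  then show "var (f j) - var (f i) \<noteq> 0 \<and> var (f j) - var (f i) + hbar \<noteq> 0"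
    using var_add_hbar_ne_0 by blast
qed

lemma generic_points_var_Z: "inj_on \<sigma> {1..n} \<Longrightarrow> generic_points n (\<lambda>b. var (Z (\<sigma> b)))"
  by (rule generic_points_var[where f = "\<lambda>b. Z (\<sigma> b)"]) (auto intro!: inj_onI dest: inj_onD)

text \<open>The support of \<open>f\<close> is finite, so a member \<open>J\<close> with maximal sum
  exists. Substituting its own points for \<open>t\<close> kills the terms of all other members of
  the same cardinality, and the term of \<open>J\<close> that is left cannot vanish.\<close>

lemma weight_map_eq_0D:
  assumes \<sigma>: "\<sigma> permutes {1..n}" and f: "f \<in> tensor_space n" and eq: "weight_map r n \<sigma> f = (\<lambda>k. 0)"
  shows "f I = 0"
proof (rule ccontr)
  assume "f I \<noteq> 0"
  let ?z = "\<lambda>b. var (Z (\<sigma> b))" and ?h = "\<lambda>I. \<Sum>(inv \<sigma> ` I)"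
  define S where "S = {I. f I \<noteq> 0}"
  have S: "S \<subseteq> Pow {1..n}" using f by (auto simp: S_def tensor_space_def)
  then have "finite S" by (rule finite_subset) simp
  moreover have "S \<noteq> {}" using \<open>f I \<noteq> 0\<close> by (auto simp: S_def)
  ultimately have "Max (?h ` S) \<in> ?h ` S" "\<And>I. I \<in> S \<Longrightarrow> ?h I \<le> Max (?h ` S)" by auto
  \<comment> \<open>Triangularity concerns positions rather than labels, so the sums to compare are
    those of the preimages under \<sigma>.\<close>
  then obtain J where J: "J \<in> S" "\<And>I. I \<in> S \<Longrightarrow> ?h I \<le> ?h J" by auto
  have inv: "inv \<sigma> permutes {1..n}" using \<sigma> by (rule permutes_inv)
  have img: "inv \<sigma> ` I \<subseteq> {1..n}" if "I \<in> Pow {1..n}" for I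
    using that permutes_image[OF inv] by blast
  have card: "card (inv \<sigma> ` I) = card I" for I
    using permutes_inj_on[OF inv] by (rule card_image)
  have gen: "generic_points n ?z" using permutes_inj_on[OF \<sigma>] by (rule generic_points_var_Z)
  let ?J = "inv \<sigma> ` J"
  have J': "?J \<subseteq> {1..n}" using J(1) S img by blast
  let ?e = "nth_elem ?J"
  have e: "bij_betw ?e {1..card J} ?J"
    using nth_elem_bij_betw[of ?J] finite_subset[OF J'] by (simp add: card)
  have emem: "?e i \<in> {1..n}" if "i \<in> {1..card J}" for i using bij_betw_apply[OF e that] J' by blast
  \<comment> \<open>\<open>hbar\<close> and the \<open>z\<close> variables stay put, so the
    coefficients \<open>f I\<close> specialise to themselves. The values at \<open>T a\<close>
    matter only for \<open>a\<close> in \<open>{1..card J}\<close>, as the weights in this summand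
    involve no other \<open>t\<close> variables.\<close>
  define v where "v = (\<lambda>x. case x of Hbar \<Rightarrow> hbar | Z b \<Rightarrow> var (Z b) | T a \<Rightarrow> ?z (?e a))"
  have spec: "specialises v (super_weight r n \<sigma> I) (W_fun r n (inv \<sigma> ` I) (?z \<circ> ?e) ?z)"
    if "I \<in> Pow {1..n}" "card I = card J" for I
  proof -
    have "specialises v (W_fun r n (inv \<sigma> ` I) (\<lambda>i. var (T i)) ?z)
      (W_fun r n (inv \<sigma> ` I) (\<lambda>i. v (T i)) ?z)"
    proof (rule specialises_W_fun[OF img[OF that(1)]])
      show "v Hbar = hbar" by (simp add: v_def)
      show "specialises v (?z b) (?z b)" for b using specialises_var[of v "Z (\<sigma> b)"] by (simp add: v_def)
      have "inj_on (\<lambda>i. Z (\<sigma> (?e i))) {1..card J}"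
        using inj_onD[OF bij_betw_imp_inj_on[OF e]] injD[OF permutes_inj[OF \<sigma>]]
        by (intro inj_onI) (metis indet.inject(1))
      then show "generic_points (card (inv \<sigma> ` I)) (\<lambda>i. v (T i))"
        unfolding v_def card that(2) indet.case
        by (rule generic_points_var[where f = "\<lambda>i. Z (\<sigma> (?e i))"]) auto
      show "?z b - v (T i) + hbar \<noteq> 0" if "b \<in> {1..n}" "i \<in> {1..card (inv \<sigma> ` I)}" for b i
      proof (cases "b = ?e i")
        case True
        then show ?thesis using hbar_ne_0 by (simp add: v_def)
      next
        case False
        have "i \<in> {1..card J}" using that(2) card \<open>card I = card J\<close> by simp
        from generic_pointsD(2)[OF gen emem[OF this] that(1)] False
        show ?thesis by (auto simp: v_def)
      qed
    qed
    then show ?thesis by (simp add: super_weight_def v_def comp_def)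
  qed
  let ?K = "{I \<in> Pow {1..n}. card I = card J}"
  have "weight_map r n \<sigma> f (card J) = (\<Sum>I\<in>?K. f I * super_weight r n \<sigma> I)"
    unfolding weight_map_def weight_vec_def by (rule sum.mono_neutral_cong_right) auto
  then have "(\<Sum>I\<in>?K. f I * super_weight r n \<sigma> I) = 0" using eq by simp
  moreover have "specialises v (\<Sum>I\<in>?K. f I * super_weight r n \<sigma> I)
      (\<Sum>I\<in>?K. f I * W_fun r n (inv \<sigma> ` I) (?z \<circ> ?e) ?z)"
    using f spec by (auto intro!: specialises_sum specialises_mult specialises_Czh[where n = n]
      simp: tensor_space_def v_def)
  ultimately have "(\<Sum>I\<in>?K. f I * W_fun r n (inv \<sigma> ` I) (?z \<circ> ?e) ?z) = 0"
    using specialises_zeroD by simp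
  moreover have "f I * W_fun r n (inv \<sigma> ` I) (?z \<circ> ?e) ?z = 0" if "I \<in> ?K - {J}" for I
  proof (rule ccontr)
    assume ne: "f I * W_fun r n (inv \<sigma> ` I) (?z \<circ> ?e) ?z \<noteq> 0"
    then have "?h I \<le> ?h J" using J(2) by (auto simp: S_def)
    moreover have "core_weight r n (inv \<sigma> ` I) (?z \<circ> ?e) ?z \<noteq> 0"
      using ne that by (auto simp: W_fun_eq[OF img])
    ultimately have "inv \<sigma> ` I = ?J"
      using core_weight_triangular(1)[OF gen img J'] e that by (auto simp: card)
    then have "I = J" using permutes_inj[OF inv] by (simp add: inj_image_eq_iff)
    with that show False by simp
  qed
  moreover have "J \<in> ?K" using J(1) S by auto
  ultimately have "f J * W_fun r n ?J (?z \<circ> ?e) ?z = 0"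
    by (subst (asm) sum.remove[of _ J]) auto
  moreover have "core_weight r n ?J (?z \<circ> ?e) ?z \<noteq> 0"
    using core_weight_triangular(2)[OF gen J' J'] e by (simp add: card)
  ultimately show False
    using J(1) prefactor_ne_0[OF gen] by (auto simp: S_def W_fun_eq[OF J'])
qed

section \<open>Exchange relations for the weight maps\<close>

text \<open>The exchange relation is translated from positions to labels. Since the inverse of
  \<open>\<sigma> \<circ> s\<close> is \<open>s\<close> after the inverse of \<sigma>, moving the
  particle to the adjacent position while passing to \<open>\<sigma> \<circ> s\<close> leaves the
  set of labels unchanged. Hence the coefficient \<open>\<zeta> / (hbar - \<zeta>)\<close> becomes
  diagonal, and the unmoved configuration yields the set with the two labels swapped.\<close>

lemma super_weight_exchange:
  fixes a :: nat and \<sigma> :: "nat \<Rightarrow> nat"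
  defines "s \<equiv> transpose a (Suc a)" and "\<zeta> \<equiv> var (Z (\<sigma> (Suc a))) - var (Z (\<sigma> a))"
  assumes \<sigma>: "\<sigma> permutes {1..n}" and a: "a \<in> {1..<n}" and I: "I \<subseteq> {1..n}"
  shows "\<sigma> a \<notin> I \<Longrightarrow> \<sigma> (Suc a) \<notin> I \<Longrightarrow>
      super_weight r n \<sigma> I = R_alpha r \<zeta> * super_weight r n (\<sigma> \<circ> s) I"
    and "\<sigma> a \<in> I \<Longrightarrow> \<sigma> (Suc a) \<in> I \<Longrightarrow>
      super_weight r n \<sigma> I = R_beta r \<zeta> * super_weight r n (\<sigma> \<circ> s) I"
    and "(\<sigma> a \<in> I) \<noteq> (\<sigma> (Suc a) \<in> I) \<Longrightarrow> super_weight r n \<sigma> I =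
      \<zeta> / (hbar - \<zeta>) * super_weight r n (\<sigma> \<circ> s) I +
      hbar / (hbar - \<zeta>) * super_weight r n (\<sigma> \<circ> s) (transpose (\<sigma> a) (\<sigma> (Suc a)) ` I)"
proof -
  let ?z = "\<lambda>b. var (Z (\<sigma> b))" and ?I = "inv \<sigma> ` I" and ?t = "\<lambda>i. var (T i)"
  have bij: "bij \<sigma>" using \<sigma> by (rule permutes_bij)
  have inv: "inv \<sigma> permutes {1..n}" using \<sigma> by (rule permutes_inv)
  have I': "?I \<subseteq> {1..n}" using I permutes_image[OF inv] by blast
  have mem: "b \<in> ?I \<longleftrightarrow> \<sigma> b \<in> I" for b
    using permutes_inverses[OF \<sigma>] by (metis imageE imageI)
  have "\<sigma> (Suc a) \<noteq> \<sigma> a" by (simp add: inj_eq[OF permutes_inj[OF \<sigma>]])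
  then have ne: "hbar - (?z (Suc a) - ?z a) \<noteq> 0"
    using var_add_hbar_ne_0(1)[of "Z (\<sigma> a)" "Z (\<sigma> (Suc a))"] by (simp add: algebra_simps)
  have gen: "generic_points (card ?I) ?t"
    by (rule generic_points_var[where f = T]) (auto intro!: inj_onI)
  have sw: "super_weight r n \<sigma> I = W_fun r n ?I ?t ?z" by (simp add: super_weight_def)
  have inv_s: "inv (\<sigma> \<circ> s) = s \<circ> inv \<sigma>"
    using bij by (simp add: o_inv_distrib s_def)
  have sws: "super_weight r n (\<sigma> \<circ> s) K = W_fun r n (s ` inv \<sigma> ` K) ?t (?z \<circ> s)" for K
    unfolding super_weight_def inv_s image_comp by (simp add: comp_def)
  have trans: "inv \<sigma> ` transpose (\<sigma> a) (\<sigma> (Suc a)) ` I = s ` ?I"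
  proof -
    have "inv \<sigma> (transpose (\<sigma> a) (\<sigma> (Suc a)) x) = s (inv \<sigma> x)" for x
      using permutes_inverses[OF \<sigma>] by (simp add: s_def transpose_def) metis
    then show ?thesis by (simp add: image_image)
  qed
  have fixed: "s ` ?I = ?I" if "\<sigma> a \<in> I \<longleftrightarrow> \<sigma> (Suc a) \<in> I"
    unfolding s_def using that by (intro transpose_image_eq) (simp add: mem)
  note ex = W_fun_exchange[where z = ?z and t = ?t and r = r, OF a ne I', folded \<zeta>_def s_def]
  show "super_weight r n \<sigma> I = R_alpha r \<zeta> * super_weight r n (\<sigma> \<circ> s) I"
    if "\<sigma> a \<notin> I" "\<sigma> (Suc a) \<notin> I"
    unfolding sw sws using ex(1) that fixed by (simp add: mem)
  show "super_weight r n \<sigma> I = R_beta r \<zeta> * super_weight r n (\<sigma> \<circ> s) I"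
    if "\<sigma> a \<in> I" "\<sigma> (Suc a) \<in> I"
    unfolding sw sws using ex(2) that fixed gen by (simp add: mem)
  show "super_weight r n \<sigma> I =
      \<zeta> / (hbar - \<zeta>) * super_weight r n (\<sigma> \<circ> s) I +
      hbar / (hbar - \<zeta>) * super_weight r n (\<sigma> \<circ> s) (transpose (\<sigma> a) (\<sigma> (Suc a)) ` I)"
    if "(\<sigma> a \<in> I) \<noteq> (\<sigma> (Suc a) \<in> I)"
  proof -
    have "\<exists>i\<in>{a, Suc a}. i \<in> ?I \<and> s i \<notin> ?I"
      using that by (auto simp: mem s_def)
    then obtain i where "i \<in> {a, Suc a}" "i \<in> ?I" "s i \<notin> ?I" by blast
    note ex(3)[OF this]
    moreover have "s ` s ` ?I = ?I" by (simp add: image_image s_def)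
    ultimately show ?thesis unfolding sw sws trans by simp
  qed
qed

text \<open>The cases of the exchange relation are the columns of the R-matrix: \<open>I\<close>
  selects the column and \<open>J\<close> the row.\<close>

lemma weight_vec_exchange:
  fixes a :: nat and \<sigma> :: "nat \<Rightarrow> nat"
  defines "s \<equiv> transpose a (Suc a)" and "u \<equiv> \<sigma> a" and "v \<equiv> \<sigma> (Suc a)"
  defines "\<zeta> \<equiv> var (Z v) - var (Z u)"
  assumes \<sigma>: "\<sigma> permutes {1..n}" and a: "a \<in> {1..<n}" and I: "I \<subseteq> {1..n}"
  shows "weight_vec r n \<sigma> I k =
    (\<Sum>J\<in>{J \<in> Pow {1..n}. \<forall>b\<in>{1..n} - {u, v}. letter I b = letter J b}.
      R_matrix r \<zeta> ! pair_index (letter J u) (letter J v) ! pair_index (letter I u) (letter I v) *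
      weight_vec r n (\<sigma> \<circ> s) J k)"
proof -
  have uv: "u \<in> {1..n}" "v \<in> {1..n}" using permutes_in_image[OF \<sigma>] a by (auto simp: u_def v_def)
  have "u \<noteq> v" by (simp add: u_def v_def inj_eq[OF permutes_inj[OF \<sigma>]])
  define I0 where "I0 = I - {u, v}"
  have I0: "u \<notin> I0" "v \<notin> I0" "finite I0" using I finite_subset by (auto simp: I0_def)
  \<comment> \<open>Agreement with \<open>I\<close> away from \<open>u\<close> and \<open>v\<close>
    leaves only the choice of occupying each of these two.\<close>
  have nbrs: "{J \<in> Pow {1..n}. \<forall>b\<in>{1..n} - {u, v}. letter I b = letter J b} =
      {I0, insert u I0, insert v I0, insert u (insert v I0)}" (is "?L = ?R")
  proof (intro equalityI subsetI)
    fix J assume "J \<in> ?L"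
    then have "J - {u, v} = I0"
      using I by (auto simp: I0_def letter_def split: if_splits)
    then show "J \<in> ?R" by (cases "u \<in> J"; cases "v \<in> J") blast+
  next
    fix J assume "J \<in> ?R"
    then show "J \<in> ?L" using I uv by (auto simp: I0_def letter_def)
  qed
  have swap: "transpose u v ` insert u I0 = insert v I0" "transpose u v ` insert v I0 = insert u I0"
    using I0 \<open>u \<noteq> v\<close> by auto
  have distinct: "insert u I0 \<noteq> I0" "insert v I0 \<noteq> I0" "insert u I0 \<noteq> insert v I0"
    "insert u (insert v I0) \<noteq> I0" "insert u (insert v I0) \<noteq> insert u I0"
    "insert u (insert v I0) \<noteq> insert v I0"
    using I0 \<open>u \<noteq> v\<close> by auto
  note ex = super_weight_exchange[OF \<sigma> a I, folded u_def v_def s_def, folded \<zeta>_def]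
  have sum: "(\<Sum>J\<in>?L. f J) = f I0 + (f (insert u I0) + (f (insert v I0) + f (insert u (insert v I0))))"
    for f :: "nat set \<Rightarrow> ratfun"
    unfolding nbrs by (simp add: distinct distinct[symmetric])
  consider "u \<notin> I" "v \<notin> I" | "u \<in> I" "v \<in> I" | "u \<in> I" "v \<notin> I" | "u \<notin> I" "v \<in> I" by blast
  then show ?thesis
  proof cases
    case 1
    then have "I = I0" by (auto simp: I0_def)
    then show ?thesis
      unfolding sum using 1 ex(1) I0 \<open>u \<noteq> v\<close>
      by (simp add: letter_def pair_index_def R_matrix_def weight_vec_def)
  next
    case 2
    then have "I = insert u (insert v I0)" by (auto simp: I0_def)
    then show ?thesis
      unfolding sum using 2 ex(2) I0 \<open>u \<noteq> v\<close>
      by (simp add: letter_def pair_index_def R_matrix_def weight_vec_def numeral_3_eq_3)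
  next
    case 3
    then have "I = insert u I0" by (auto simp: I0_def)
    then show ?thesis
      unfolding sum using 3 ex(3) I0 \<open>u \<noteq> v\<close>
      by (simp add: letter_def pair_index_def R_matrix_def weight_vec_def swap)
  next
    case 4
    then have "I = insert v I0" by (auto simp: I0_def)
    then show ?thesis
      unfolding sum using 4 ex(3) I0 \<open>u \<noteq> v\<close>
      by (simp add: letter_def pair_index_def R_matrix_def weight_vec_def swap)
  qed
qed

text \<open>The defining relation of local tensor coordinates without the inverse. It is obtained by
  linearity from the basis tensors and an exchange of the two summations.\<close>

lemma weight_map_exchange:
  fixes a :: nat and \<sigma> :: "nat \<Rightarrow> nat"
  assumes "\<sigma> permutes {1..n}" "a \<in> {1..<n}"
  shows "weight_map r n \<sigma> f = weight_map r n (\<sigma> \<circ> transpose a (Suc a))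
    (act_in_factors n (R_matrix r (var (Z (\<sigma> (Suc a))) - var (Z (\<sigma> a)))) (\<sigma> a) (\<sigma> (Suc a)) f)"
proof
  fix k
  let ?s = "transpose a (Suc a)" and ?u = "\<sigma> a" and ?v = "\<sigma> (Suc a)"
  let ?M = "\<lambda>J I. R_matrix r (var (Z ?v) - var (Z ?u)) ! pair_index (letter J ?u) (letter J ?v) !
    pair_index (letter I ?u) (letter I ?v)"
  let ?rel = "\<lambda>I J. \<forall>b\<in>{1..n} - {?u, ?v}. letter I b = letter J b"
  have "weight_map r n \<sigma> f k = (\<Sum>I\<in>Pow {1..n}. \<Sum>J\<in>{J \<in> Pow {1..n}. ?rel I J}.
      ?M J I * f I * weight_vec r n (\<sigma> \<circ> ?s) J k)"
    unfolding weight_map_def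
    by (intro sum.cong refl, subst weight_vec_exchange[OF assms]) (auto simp: sum_distrib_left mult_ac)
  also have "\<dots> = (\<Sum>J\<in>Pow {1..n}. \<Sum>I\<in>{I \<in> Pow {1..n}. ?rel I J}.
      ?M J I * f I * weight_vec r n (\<sigma> \<circ> ?s) J k)"
    by (rule sum.swap_restrict) simp_all
  also have "\<dots> = weight_map r n (\<sigma> \<circ> ?s)
      (act_in_factors n (R_matrix r (var (Z ?v) - var (Z ?u))) ?u ?v f) k"
    unfolding weight_map_def act_in_factors_def
    by (intro sum.cong refl) (simp add: sum_distrib_right)
  finally show "weight_map r n \<sigma> f k = weight_map r n (\<sigma> \<circ> ?s)
      (act_in_factors n (R_matrix r (var (Z ?v) - var (Z ?u))) ?u ?v f) k" .
qed

section \<open>The R-matrix acts over the field of scalars\<close>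

lemma R_matrix_in_Czh:
  assumes "\<zeta> \<in> Czh n" "i < 4" "j < 4"
  shows "R_matrix r \<zeta> ! i ! j \<in> Czh n"
proof -
  have "R_alpha r \<zeta> \<in> Czh n" "R_beta r \<zeta> \<in> Czh n"
    using assms(1) by (cases r; simp add: R_alpha_def R_beta_def Czh_divide Czh_add Czh_diff)+
  moreover have "\<zeta> / (hbar - \<zeta>) \<in> Czh n" "hbar / (hbar - \<zeta>) \<in> Czh n"
    using assms(1) by (simp_all add: Czh_divide Czh_diff)
  moreover have "i = 0 \<or> i = 1 \<or> i = 2 \<or> i = 3" "j = 0 \<or> j = 1 \<or> j = 2 \<or> j = 3"
    using assms(2,3) by auto
  ultimately show ?thesis by (elim disjE) (simp_all add: R_matrix_def)
qed

lemma act_in_factors_in_tensor_space: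
  assumes "f \<in> tensor_space n" "\<zeta> \<in> Czh n"
  shows "act_in_factors n (R_matrix r \<zeta>) u v f \<in> tensor_space n"
proof -
  have "pair_index (letter I u) (letter I v) < 4" for I
    by (simp add: pair_index_def letter_def)
  then show ?thesis
    using assms unfolding tensor_space_def act_in_factors_def
    by (auto intro!: Czh_sum Czh_mult R_matrix_in_Czh)
qed

section \<open>Linear algebra\<close>

lemma tensor_space_add: "f \<in> tensor_space n \<Longrightarrow> g \<in> tensor_space n \<Longrightarrow> (\<lambda>I. f I + g I) \<in> tensor_space n"
  by (simp add: tensor_space_def Czh_add)

lemma tensor_space_diff: "f \<in> tensor_space n \<Longrightarrow> g \<in> tensor_space n \<Longrightarrow> (\<lambda>I. f I - g I) \<in> tensor_space n"
  by (simp add: tensor_space_def Czh_diff)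

lemma tensor_space_scale: "c \<in> Czh n \<Longrightarrow> f \<in> tensor_space n \<Longrightarrow> (\<lambda>I. c * f I) \<in> tensor_space n"
  by (simp add: tensor_space_def Czh_mult)

lemma weight_map_add: "weight_map r n \<sigma> (\<lambda>I. f I + g I) = (\<lambda>k. weight_map r n \<sigma> f k + weight_map r n \<sigma> g k)"
  by (simp add: weight_map_def distrib_right sum.distrib)

lemma weight_map_diff: "weight_map r n \<sigma> (\<lambda>I. f I - g I) = (\<lambda>k. weight_map r n \<sigma> f k - weight_map r n \<sigma> g k)"
  by (simp add: weight_map_def left_diff_distrib sum_subtractf)

lemma weight_map_scale: "weight_map r n \<sigma> (\<lambda>I. c * f I) = (\<lambda>k. c * weight_map r n \<sigma> f k)"
  by (simp add: weight_map_def sum_distrib_left mult_ac)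

section \<open>Injectivity and images of the weight maps\<close>

lemma inj_on_weight_map:
  assumes "\<sigma> permutes {1..n}"
  shows "inj_on (weight_map r n \<sigma>) (tensor_space n)"
proof (rule inj_onI)
  fix f g assume fg: "f \<in> tensor_space n" "g \<in> tensor_space n" "weight_map r n \<sigma> f = weight_map r n \<sigma> g"
  then have "weight_map r n \<sigma> (\<lambda>I. f I - g I) = (\<lambda>k. 0)" by (simp add: weight_map_diff)
  from weight_map_eq_0D[OF assms tensor_space_diff[OF fg(1,2)] this]
  show "f = g" by (simp add: fun_eq_iff)
qed

lemma weight_map_unit:
  assumes "I \<subseteq> {1..n}"
  shows "(\<lambda>J. if J = I then 1 else 0) \<in> tensor_space n"
    and "weight_map r n \<sigma> (\<lambda>J. if J = I then 1 else 0) = weight_vec r n \<sigma> I"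
proof -
  show "(\<lambda>J. if J = I then 1 else 0) \<in> tensor_space n" using assms by (auto simp: tensor_space_def)
  have "(if J = I then 1 else 0) * w = (if J = I then w else 0)" for J and w :: ratfun by simp
  then show "weight_map r n \<sigma> (\<lambda>J. if J = I then 1 else 0) = weight_vec r n \<sigma> I"
    using assms by (simp add: weight_map_def)
qed

lemma weight_vec_in_image:
  assumes "I \<subseteq> {1..n}" shows "weight_vec r n \<sigma> I \<in> weight_map r n \<sigma> ` tensor_space n"
  by (subst weight_map_unit(2)[OF assms, symmetric]) (intro imageI weight_map_unit(1) assms)

text \<open>The exchange relation compares the images for \<open>\<sigma>\<close> and
  \<open>\<sigma> \<circ> s\<close> with \<open>s\<close> adjacent, and adjacent transpositions
  generate the symmetric group.\<close>

lemma weight_map_image_eq: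
  assumes "\<sigma> permutes {1..n}"
  shows "weight_map r n \<sigma> ` tensor_space n = weight_map r n id ` tensor_space n"
proof -
  let ?im = "\<lambda>\<sigma>. weight_map r n \<sigma> ` tensor_space n"
  have step: "?im \<sigma> \<subseteq> ?im (\<sigma> \<circ> transpose a (Suc a))" if "\<sigma> permutes {1..n}" "a \<in> {1..<n}" for \<sigma> a
  proof -
    have "\<sigma> a \<in> {1..n}" "\<sigma> (Suc a) \<in> {1..n}"
      using that by (auto simp only: permutes_in_image[OF that(1)]) auto
    then have "var (Z (\<sigma> (Suc a))) - var (Z (\<sigma> a)) \<in> Czh n" by (intro Czh_diff Czh_var_Z)
    then show ?thesis
      using weight_map_exchange[OF that] act_in_factors_in_tensor_space by (metis image_subsetI imageI)
  qed
  have adjacent: "?im (\<sigma> \<circ> transpose a (Suc a)) = ?im \<sigma>" if "\<sigma> permutes {1..n}" "a \<in> {1..<n}" for \<sigma> a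
  proof -
    have "\<sigma> \<circ> transpose a (Suc a) permutes {1..n}"
      using that by (intro permutes_compose permutes_swap_id) auto
    \<comment> \<open>Applying the inclusion to \<open>\<sigma> \<circ> s\<close> leads back to
      \<sigma>, since \<open>s\<close> is an involution; this takes the place of inverting the
      R-matrix.\<close>
    from step[OF this that(2)] step[OF that] show ?thesis by (auto simp: comp_assoc)
  qed
  have le: "?im (\<sigma> \<circ> transpose a (a + Suc d)) = ?im \<sigma>"
    if "\<sigma> permutes {1..n}" "1 \<le> a" "a + Suc d \<le> n" for \<sigma> a d
    using that
  proof (induction d arbitrary: \<sigma>)
    case 0
    then show ?case using adjacent[of \<sigma> a] by (simp add: comp_def)
  next
    case (Suc d)
    let ?t = "transpose (Suc (a + d)) (Suc (Suc (a + d)))" and ?q = "transpose a (a + Suc d)"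
    have p1: "\<sigma> \<circ> ?t permutes {1..n}" using Suc.prems by (intro permutes_compose permutes_swap_id) auto
    have p2: "\<sigma> \<circ> ?t \<circ> ?q permutes {1..n}"
      using Suc.prems by (intro permutes_compose[OF _ p1] permutes_swap_id) auto
    \<comment> \<open>Conjugation by an adjacent transposition shortens the distance by one;
      \<open>d = 0\<close> is the adjacent case itself.\<close>
    have "transpose a (a + Suc (Suc d)) = ?t \<circ> ?q \<circ> ?t"
      using transpose_comp_triple[of "Suc (Suc (a + d))" a "Suc (a + d)"]
      by (simp add: transpose_commute)
    then have "?im (\<sigma> \<circ> transpose a (a + Suc (Suc d))) = ?im (\<sigma> \<circ> ?t \<circ> ?q \<circ> ?t)"
      by (simp only: comp_assoc)
    also have "\<dots> = ?im \<sigma>"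
      using adjacent[OF p2, of "Suc (a + d)"] Suc.IH[OF p1] adjacent[of \<sigma> "Suc (a + d)"] Suc.prems
      by (simp add: comp_def)
    finally show ?case .
  qed
  have lt: "?im (\<sigma> \<circ> transpose a b) = ?im \<sigma>"
    if "\<sigma> permutes {1..n}" "a \<in> {1..n}" "b \<in> {1..n}" "a < b" for \<sigma> a b
  proof -
    obtain d where "b = a + Suc d" using \<open>a < b\<close> less_imp_Suc_add by fastforce
    then show ?thesis using le[OF that(1), of a d] that by simp
  qed
  show ?thesis
    using finite_atLeastAtMost[of 1 n] assms
  proof (induction rule: permutes_rev_induct)
    case id
    show ?case by simp
  next
    case (swap a b p)
    then show ?case
      using lt[of p a b] lt[of p b a] by (cases a b rule: linorder_cases) (simp_all add: transpose_commute comp_def)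
  qed
qed

section \<open>Spans and dimension\<close>

lemma is_subspace_weight_map_image: "is_subspace n (weight_map r n \<sigma> ` tensor_space n)"
  unfolding is_subspace_def
proof (intro conjI ballI)
  have "weight_map r n \<sigma> (\<lambda>I. 0) = (\<lambda>k. 0)" by (simp add: weight_map_def)
  moreover have "(\<lambda>I. 0) \<in> tensor_space n" by (simp add: tensor_space_def)
  ultimately show "(\<lambda>k. 0) \<in> weight_map r n \<sigma> ` tensor_space n" by (metis imageI)
qed (auto simp flip: weight_map_add weight_map_scale intro: tensor_space_add tensor_space_scale)

lemma zh_span_subset:
  assumes "is_subspace n V" "S \<subseteq> V"
  shows "zh_span n S \<subseteq> V"
proof -
  have "lincomb A c \<in> V" if "finite A" "A \<subseteq> V" "\<forall>v\<in>A. c v \<in> Czh n" for A c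
    using that
  proof (induction A rule: finite_induct)
    case empty
    then show ?case using assms(1) by (simp add: lincomb_def is_subspace_def)
  next
    case (insert w A)
    have "(\<lambda>i. c w * w i) \<in> V" "lincomb A c \<in> V"
      using insert assms(1) by (auto simp: is_subspace_def)
    then have "(\<lambda>i. c w * w i + lincomb A c i) \<in> V" using assms(1) by (simp add: is_subspace_def)
    then show ?case using insert.hyps by (simp add: lincomb_def)
  qed
  then show ?thesis unfolding zh_span_def using assms(2) by blast
qed

lemma zh_span_mono: "S \<subseteq> S' \<Longrightarrow> zh_span n S \<subseteq> zh_span n S'"
  unfolding zh_span_def by (intro Collect_mono impI, elim exE conjE, intro exI conjI) (assumption | erule order_trans)+

text \<open>Distinct unit tensors have distinct images. This matters because linear combinations are
  indexed by vectors and not by subsets: coinciding vectors would merge coefficients and spoil the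
  dimension count.\<close>

lemma inj_on_weight_vec:
  assumes "\<sigma> permutes {1..n}"
  shows "inj_on (weight_vec r n \<sigma>) (Pow {1..n})"
proof (rule inj_onI)
  fix I J assume IJ: "I \<in> Pow {1..n}" "J \<in> Pow {1..n}" "weight_vec r n \<sigma> I = weight_vec r n \<sigma> J"
  then have "(\<lambda>K. if K = I then 1 else 0) = (\<lambda>K. if K = J then 1 else 0 :: ratfun)"
    using weight_map_unit by (intro inj_onD[OF inj_on_weight_map[OF assms]]) simp_all
  then show "I = J" by (metis zero_neq_one)
qed

lemma lincomb_weight_vec:
  assumes "\<sigma> permutes {1..n}" "A \<subseteq> weight_vec r n \<sigma> ` Pow {1..n}"
  shows "lincomb A c = weight_map r n \<sigma>
    (\<lambda>I. if I \<subseteq> {1..n} \<and> weight_vec r n \<sigma> I \<in> A then c (weight_vec r n \<sigma> I) else 0)"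
proof
  fix k
  let ?w = "weight_vec r n \<sigma>" and ?X = "{I \<in> Pow {1..n}. weight_vec r n \<sigma> I \<in> A}"
  have A: "A = ?w ` ?X" using assms(2) by auto
  have inj: "inj_on ?w ?X" using inj_on_weight_vec[OF assms(1)] by (rule inj_on_subset) auto
  have "lincomb A c k = (\<Sum>v\<in>?w ` ?X. c v * v k)" unfolding lincomb_def using A by simp
  also have "\<dots> = (\<Sum>I\<in>?X. c (?w I) * ?w I k)" by (simp only: sum.reindex[OF inj] comp_def)
  also have "\<dots> = weight_map r n \<sigma> (\<lambda>I. if I \<subseteq> {1..n} \<and> ?w I \<in> A then c (?w I) else 0) k"
    unfolding weight_map_def by (rule sum.mono_neutral_cong_left) auto
  finally show "lincomb A c k =
    weight_map r n \<sigma> (\<lambda>I. if I \<subseteq> {1..n} \<and> ?w I \<in> A then c (?w I) else 0) k" .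
qed

lemma zh_span_weight_vec:
  assumes "\<sigma> permutes {1..n}"
  shows "zh_span n (weight_vec r n \<sigma> ` Pow {1..n}) = weight_map r n \<sigma> ` tensor_space n"
proof
  show "zh_span n (weight_vec r n \<sigma> ` Pow {1..n}) \<subseteq> weight_map r n \<sigma> ` tensor_space n"
    using weight_vec_in_image by (intro zh_span_subset is_subspace_weight_map_image) auto
  show "weight_map r n \<sigma> ` tensor_space n \<subseteq> zh_span n (weight_vec r n \<sigma> ` Pow {1..n})"
  proof (rule image_subsetI)
    fix f assume f: "f \<in> tensor_space n"
    let ?w = "weight_vec r n \<sigma>"
    \<comment> \<open>Coefficients attach to vectors, so \<open>f\<close> is transported along the
      inverse of the injective indexing by subsets.\<close>
    define c where "c = (\<lambda>v. f (inv_into (Pow {1..n}) ?w v))"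
    have c: "c (?w I) = f I" if "I \<subseteq> {1..n}" for I
      using inj_on_weight_vec[OF assms, of r] that by (simp add: c_def)
    have "lincomb (?w ` Pow {1..n}) c =
        weight_map r n \<sigma> (\<lambda>I. if I \<subseteq> {1..n} \<and> ?w I \<in> ?w ` Pow {1..n} then c (?w I) else 0)"
      using assms by (rule lincomb_weight_vec) simp
    also have "\<dots> = weight_map r n \<sigma> f"
      unfolding weight_map_def by (rule ext, rule sum.cong) (auto simp: c)
    finally show "weight_map r n \<sigma> f \<in> zh_span n (?w ` Pow {1..n})"
      unfolding zh_span_def using f c
      by (intro CollectI exI[of _ "?w ` Pow {1..n}"] exI[of _ c]) (auto simp: tensor_space_def)
  qed
qed

text \<open>The space is a span over all permutations at once. Each generator lies in the image of
  its own weight map, and these images coincide, so a single permutation suffices.\<close>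

lemma weight_space_eq:
  assumes "\<sigma> permutes {1..n}"
  shows "weight_space r n = weight_map r n \<sigma> ` tensor_space n"
proof
  have mem: "weight_vec r n \<tau> I \<in> weight_map r n \<sigma> ` tensor_space n"
    if "\<tau> permutes {1..n}" "I \<subseteq> {1..n}" for \<tau> I
    unfolding weight_map_image_eq[OF assms] weight_map_image_eq[OF that(1), symmetric]
    using that(2) by (rule weight_vec_in_image)
  then show "weight_space r n \<subseteq> weight_map r n \<sigma> ` tensor_space n"
    unfolding weight_space_def by (intro zh_span_subset is_subspace_weight_map_image) auto
  have "weight_vec r n \<sigma> ` Pow {1..n} \<subseteq> {weight_vec r n \<sigma> I | \<sigma> I. \<sigma> permutes {1..n} \<and> I \<subseteq> {1..n}}"
    using assms by auto
  then have "zh_span n (weight_vec r n \<sigma> ` Pow {1..n}) \<subseteq> weight_space r n"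
    unfolding weight_space_def by (rule zh_span_mono)
  then show "weight_map r n \<sigma> ` tensor_space n \<subseteq> weight_space r n"
    by (simp only: zh_span_weight_vec[OF assms])
qed

lemma has_dimension_weight_space: "has_dimension n (weight_space r n) (2 ^ n)"
  unfolding has_dimension_def
proof (intro exI conjI)
  let ?w = "weight_vec r n id" and ?B = "weight_vec r n id ` Pow {1..n}"
  have id: "id permutes {1..n}" by (rule permutes_id)
  show span: "zh_span n ?B = weight_space r n"
    by (simp only: zh_span_weight_vec[OF id] weight_space_eq[OF id])
  show "finite ?B" by simp
  show "card ?B = 2 ^ n"
    using inj_on_weight_vec[OF id] by (simp add: card_image card_Pow)
  show "?B \<subseteq> weight_space r n"
  proof (rule image_subsetI)
    fix I assume "I \<in> Pow {1..n}"
    then show "?w I \<in> weight_space r n"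
      unfolding weight_space_eq[OF id] by (intro weight_vec_in_image) simp
  qed
  show "zh_independent n ?B"
    unfolding zh_independent_def
  proof (intro allI impI ballI)
    fix A c v
    assume A: "A \<subseteq> ?B" "\<forall>v\<in>A. c v \<in> Czh n" "lincomb A c = (\<lambda>i. 0)" "v \<in> A"
    \<comment> \<open>The coefficients of the combination extended by 0 to a tensor, to which
      injectivity of the weight map applies.\<close>
    let ?f = "\<lambda>I. if I \<subseteq> {1..n} \<and> ?w I \<in> A then c (?w I) else 0"
    have "?f \<in> tensor_space n" using A(2) by (auto simp: tensor_space_def)
    moreover have "weight_map r n id ?f = (\<lambda>k. 0)"
      using A(3) lincomb_weight_vec[OF id A(1)] by simp
    ultimately have "?f I = 0" for I by (rule weight_map_eq_0D[OF id])
    moreover obtain I where "I \<subseteq> {1..n}" "v = ?w I" using A(1,4) by auto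
    ultimately show "c v = 0" using A(4) by metis
  qed
qed

theorem theorem8p4:
  fixes n :: nat and r :: kind
  assumes "n \<ge> 1"
  shows "local_tensor_coordinates n (R_matrix r) (weight_space r n) (weight_map r n)"
  unfolding local_tensor_coordinates_def
proof (intro conjI allI impI ballI)
  show "is_subspace n (weight_space r n)"
    unfolding weight_space_eq[OF permutes_id] by (rule is_subspace_weight_map_image)
  show "has_dimension n (weight_space r n) (2 ^ n)" by (rule has_dimension_weight_space)
  show "linear_iso n (tensor_space n) (weight_space r n) (weight_map r n \<sigma>)"
    if "\<sigma> permutes {1..n}" for \<sigma>
    unfolding linear_iso_def bij_betw_def
    using inj_on_weight_map[OF that] weight_space_eq[OF that]
    by (simp add: weight_map_add weight_map_scale)
  show "inv_into (tensor_space n) (weight_map r n (\<sigma> \<circ> Transposition.transpose a (a + 1)))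
      (weight_map r n \<sigma> f) =
    act_in_factors n (R_matrix r (var (Z (\<sigma> (a + 1))) - var (Z (\<sigma> a)))) (\<sigma> a) (\<sigma> (a + 1)) f"
    if "\<sigma> permutes {1..n}" "a \<in> {1..<n}" "f \<in> tensor_space n" for \<sigma> a f
  \<comment> \<open>The image of \<open>f\<close> under the R-matrix lies in the tensor space and is
    a preimage of \<open>weight_map r n \<sigma> f\<close>; injectivity makes it the only
    one.\<close>
  proof (rule inv_into_f_eq)
    have "\<sigma> \<circ> Transposition.transpose a (a + 1) permutes {1..n}"
      using that(1,2) by (intro permutes_compose permutes_swap_id) auto
    then show "inj_on (weight_map r n (\<sigma> \<circ> Transposition.transpose a (a + 1))) (tensor_space n)"
      by (rule inj_on_weight_map)
    have "\<sigma> a \<in> {1..n}" "\<sigma> (a + 1) \<in> {1..n}"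
      using that(2) by (auto simp only: permutes_in_image[OF that(1)]) auto
    then show "act_in_factors n (R_matrix r (var (Z (\<sigma> (a + 1))) - var (Z (\<sigma> a)))) (\<sigma> a) (\<sigma> (a + 1)) f
        \<in> tensor_space n"
      by (intro act_in_factors_in_tensor_space that(3) Czh_diff Czh_var_Z)
    show "weight_map r n (\<sigma> \<circ> Transposition.transpose a (a + 1))
        (act_in_factors n (R_matrix r (var (Z (\<sigma> (a + 1))) - var (Z (\<sigma> a)))) (\<sigma> a) (\<sigma> (a + 1)) f) =
      weight_map r n \<sigma> f"
      using weight_map_exchange[OF that(1,2)] by simp
  qed
qed

end
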